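(* Let $r\geq 1$ be an integer, put $d=2r-1$, and let $\beta>0$ and $0<c<1$. Define polynomials $\mathcal{M}_n(x;\beta,c,d)$, $n\ge 0$, by the generating function $$\sum_{n=0}^{\infty}\mathcal{M}_n(x;\beta,c,d)\frac{z^n}{n!}=\exp\Big(z+\frac{(-1)^r}{1-c}z^r\Big)\,{}_1F_1\left(\begin{matrix}-x\\ \beta\end{matrix};-z\right).$$ For $i\in\{0,1,\dots,d-1\}$ and integers $k\ge 0$ put $$w_{i\,k}=\frac{(-1)^i(1-c)^{\frac{\beta+i}{r}}}{r\,\Gamma(\beta)\sqrt{i!(\beta)_i}}\sum_{s=0}^{r-1}\frac{(-k)_s\,(1-c)^{s/r}}{s!(\beta)_s}\Gamma\Big(\frac{\beta+i+s}{r}\Big)\;{}_{r+2}F_{2r}\left(\begin{matrix}1,\ \Delta(r,-k+s),\ \frac{\beta+s+i}{r}\\ \Delta(r,\beta+s),\ \Delta(r,s+1)\end{matrix};\frac{1-c}{r^r}\right),$$ and define linear functionals on polynomials by $$\mathcal{L}_i(f)=\sum_{k=0}^{\infty}w_{i\,k}\frac{(\beta)_k}{k!}f(k).$$ Then $\{\mathcal{M}_n(x;\beta,c,d)\}_{n\ge0}$ is a $d$-orthogonal polynomial set with respect to the functional vector $(\mathcal{L}_0,\mathcal{L}_1,\dots,\mathcal{L}_{d-1})$.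
   Context: $(a)_n=a(a+1)\cdots(a+n-1)$, $(a)_0=1$, is the Pochhammer symbol, and ${}_pF_q\left(\begin{matrix}a_1,\dots,a_p\\ b_1,\dots,b_q\end{matrix};x\right)=\sum_{m\ge0}\frac{(a_1)_m\cdots(a_p)_m}{(b_1)_m\cdots(b_q)_m}\frac{x^m}{m!}$. For an integer $r\ge1$ and a number $m$, $\Delta(r,m)$ denotes the list of $r$ parameters $\frac{m}{r},\frac{m+1}{r},\dots,\frac{m+r-1}{r}$. A polynomial set is a sequence $\{Q_n\}_{n\ge0}$ of complex polynomials with $\deg Q_n=n$ for all $n$. For a positive integer $d$, a polynomial set $\{Q_n\}_{n\ge0}$ is a $d$-orthogonal polynomial set with respect to a vector $(\mathcal{L}_0,\dots,\mathcal{L}_{d-1})$ of linear functionals on the space of polynomials if for each $i\in\{0,\dots,d-1\}$: $\mathcal{L}_i(Q_mQ_n)=0$ whenever $n\ge md+i+1$, and $\mathcal{L}_i(Q_nQ_{nd+i})\neq0$ for all $n\ge0$. *)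

theory Defs
  imports "HOL-Analysis.Analysis" "HOL-Computational_Algebra.Computational_Algebra"
begin

definition hypergeomF :: "real list \<Rightarrow> real list \<Rightarrow> real \<Rightarrow> real" where
  "hypergeomF as bs x =
     (\<Sum>m. (\<Prod>a\<leftarrow>as. pochhammer a m) / (\<Prod>b\<leftarrow>bs. pochhammer b m) * x ^ m / fact m)"

definition Delta :: "nat \<Rightarrow> real \<Rightarrow> real list" where
  "Delta r m = map (\<lambda>j. (m + real j) / real r) [0..<r]"

definition expPart :: "nat \<Rightarrow> real \<Rightarrow> real fps" where
  "expPart r c = fps_exp 1 * (fps_exp ((-1) ^ r / (1 - c)) oo (fps_X ^ r))"

text \<open>Formal power series 1F1(-x; beta; -z) in z, with coefficients polynomials in x.\<close>
definition hypPart :: "real \<Rightarrow> real poly fps" where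
  "hypPart \<beta> = Abs_fps (\<lambda>k. smult ((-1) ^ k / (pochhammer \<beta> k * fact k))
                                   (pochhammer (- [:0, 1:]) k))"

definition genM :: "nat \<Rightarrow> real \<Rightarrow> real \<Rightarrow> real poly fps" where
  "genM r \<beta> c = Abs_fps (\<lambda>m. [: fps_nth (expPart r c) m :]) * hypPart \<beta>"

definition Mpoly :: "nat \<Rightarrow> real \<Rightarrow> real \<Rightarrow> nat \<Rightarrow> real poly" where
  "Mpoly r \<beta> c n = smult (fact n) (fps_nth (genM r \<beta> c) n)"

definition wgt :: "nat \<Rightarrow> real \<Rightarrow> real \<Rightarrow> nat \<Rightarrow> nat \<Rightarrow> real" where
  "wgt r \<beta> c i k =
     (-1) ^ i * (1 - c) powr ((\<beta> + real i) / real r)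
       / (real r * Gamma \<beta> * sqrt (fact i * pochhammer \<beta> i))
     * (\<Sum>s<r. pochhammer (- real k) s * (1 - c) powr (real s / real r)
                 / (fact s * pochhammer \<beta> s)
               * Gamma ((\<beta> + real i + real s) / real r)
               * hypergeomF ([1] @ Delta r (- real k + real s) @ [(\<beta> + real s + real i) / real r])
                            (Delta r (\<beta> + real s) @ Delta r (real s + 1))
                            ((1 - c) / real r ^ r))"

definition Lterm :: "nat \<Rightarrow> real \<Rightarrow> real \<Rightarrow> nat \<Rightarrow> real poly \<Rightarrow> nat \<Rightarrow> real" where
  "Lterm r \<beta> c i f k = wgt r \<beta> c i k * pochhammer \<beta> k / fact k * poly f (real k)"

definition Lfun :: "nat \<Rightarrow> real \<Rightarrow> real \<Rightarrow> nat \<Rightarrow> real poly \<Rightarrow> real" where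
  "Lfun r \<beta> c i f = (\<Sum>k. Lterm r \<beta> c i f k)"

definition d_orthogonal :: "nat \<Rightarrow> (nat \<Rightarrow> 'a::comm_ring_1 poly) \<Rightarrow> (nat \<Rightarrow> 'a poly \<Rightarrow> 'a) \<Rightarrow> bool" where
  "d_orthogonal d Q L \<longleftrightarrow>
     (\<forall>n. degree (Q n) = n) \<and>
     (\<forall>i<d. (\<forall>m n. n \<ge> m * d + i + 1 \<longrightarrow> L i (Q m * Q n) = 0) \<and>
            (\<forall>n. L i (Q n * Q (n * d + i)) \<noteq> 0))"

end

theory Submission
  imports Defs "HOL-Real_Asymp.Real_Asymp"
begin

text \<open>
  Write \<open>P\<^sub>k(t) = 1F1(-k; \<beta>; t)\<close>, a multiple of a Laguerre polynomial. Up to a constant, the weight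
  \<open>w\<^sub>i\<^sub>k\<close> is \<open>\<integral> t\<^bsup>\<beta>-1\<^esup> e\<^bsup>-t\<^esup> P\<^sub>k(t) g(t) dt\<close> over the half-line, where \<open>g(t) = t\<^sup>i exp (t - t\<^sup>r / (1 - c))\<close>
  is smooth with bounded derivatives. Integrating by parts trades \<open>(\<beta>, k + 1, g)\<close> for \<open>(\<beta> + 1, k, g')\<close>;
  iterating this and using the norm of the Laguerre polynomials gives decay faster than any power of \<open>k\<close>.
  Since \<open>\<Sum>\<^bsub>k\<le>K\<^esub> (\<beta>)\<^sub>k / k! P\<^sub>k\<close> is again a Laguerre polynomial, with parameter \<open>\<beta> + 1\<close>, the sum over \<open>k\<close> of
  the integrals times \<open>(\<beta>)\<^sub>k / k!\<close> equals \<open>\<Gamma>(\<beta>) g(0)\<close>, and with the extra factor \<open>(-k)\<^sub>n\<close> it equals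
  \<open>\<Gamma>(\<beta> + n) g\<^bsup>(n)\<^esup>(0)\<close>. Hence \<open>L\<^sub>i\<close> maps the series \<open>1F1(-x; \<beta>; -z)\<close> to a multiple of \<open>g(-z)\<close>, and the
  generating function of the polynomials to a multiple of \<open>z\<^sup>i\<close>.

  Multiplication by \<open>x\<close> acts on \<open>1F1(-x; \<beta>; -z)\<close> as the differential operator
  \<open>z D\<^sup>2 + (\<beta> + z) D\<close>; conjugated by the exponential factor this operator raises the degree of a polynomial
  in \<open>z\<close> by exactly \<open>2 r - 1\<close>. So the sequence \<open>n \<mapsto> L\<^sub>i(q M\<^sub>n) / n!\<close> consists of the coefficients of a
  polynomial of degree exactly \<open>i + (2 r - 1) deg q\<close>, which is the d-orthogonality.
\<close>

subsection \<open>Laguerre polynomials\<close>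

text \<open>The terminating series \<open>1F1(-k; \<beta>; t)\<close>, i.e. \<open>k! / (\<beta>)\<^sub>k\<close> times the Laguerre polynomial with parameter \<open>\<beta> - 1\<close>.\<close>

definition lagP :: "real \<Rightarrow> nat \<Rightarrow> real poly" where
  "lagP \<beta> k = (\<Sum>j\<le>k. monom (pochhammer (- real k) j / (pochhammer \<beta> j * fact j)) j)"

lemma coeff_lagP: "coeff (lagP \<beta> k) j = pochhammer (- real k) j / (pochhammer \<beta> j * fact j)"
  by (auto simp: lagP_def coeff_sum pochhammer_of_nat_eq_0_iff)

lemma degree_lagP_le: "degree (lagP \<beta> k) \<le> k"
  by (rule degree_le) (simp add: coeff_lagP pochhammer_of_nat_eq_0_iff)

lemma lagP_0 [simp]: "lagP \<beta> 0 = 1"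
  by (simp add: lagP_def monom_0)

text \<open>One step of Rodrigues' formula: after multiplication by t^(\<beta>-1) e^(-t), the left
  side is the derivative of t^\<beta> e^(-t) times \<open>lagP (\<beta> + 1) k\<close>. It drives
  the integration by parts in \<open>lagW_Suc\<close>.\<close>

lemma lagP_Rodrigues_step:
  assumes "\<beta> > 0"
  shows "smult \<beta> (lagP (\<beta> + 1) k) + [:0, 1:] * pderiv (lagP (\<beta> + 1) k) - [:0, 1:] * lagP (\<beta> + 1) k
           = smult \<beta> (lagP \<beta> (Suc k))"
proof (rule poly_eqI)
  fix j
  show "coeff (smult \<beta> (lagP (\<beta> + 1) k) + [:0, 1:] * pderiv (lagP (\<beta> + 1) k) - [:0, 1:] * lagP (\<beta> + 1) k) j
          = coeff (smult \<beta> (lagP \<beta> (Suc k))) j"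
  proof (cases j)
    case 0
    then show ?thesis by (simp add: coeff_lagP coeff_pCons)
  next
    case (Suc l)
    define a where "a = pochhammer (- real k) l"
    define p where "p = pochhammer (\<beta> + 1) l"
    have p: "p > 0" using assms by (simp add: p_def pochhammer_pos)
    have e1: "pochhammer (- real k) (Suc l) = a * (real l - real k)"
      by (simp add: pochhammer_Suc a_def)
    have e2: "pochhammer (- real (Suc k)) (Suc l) = - (real k + 1) * a"
      by (simp add: pochhammer_rec a_def)
    have e3: "pochhammer (\<beta> + 1) (Suc l) = p * (\<beta> + 1 + real l)"
      by (simp add: pochhammer_Suc p_def)
    have e4: "pochhammer \<beta> (Suc l) = \<beta> * p"
      by (simp add: pochhammer_rec p_def)
    have nz: "\<beta> + 1 + real l \<noteq> 0" "p \<noteq> 0" "\<beta> \<noteq> 0" using assms p by auto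
    have "coeff (smult \<beta> (lagP (\<beta> + 1) k) + [:0, 1:] * pderiv (lagP (\<beta> + 1) k) - [:0, 1:] * lagP (\<beta> + 1) k) j
          = (\<beta> + real (Suc l)) * (pochhammer (- real k) (Suc l) / (pochhammer (\<beta> + 1) (Suc l) * fact (Suc l)))
             - a / (p * fact l)"
      by (simp add: Suc coeff_lagP coeff_pderiv a_def p_def coeff_pCons ring_distribs del: fact_Suc flip: add_divide_distrib)
    also have "\<dots> = a * (real l - real k) / (p * fact (Suc l)) - a / (p * fact l)"
      unfolding e1 e3 using nz by (simp add: divide_simps del: fact_Suc) (simp add: algebra_simps)
    also have "\<dots> = - (real k + 1) * a / (p * fact (Suc l))"
      using nz by (simp add: divide_simps) (simp add: algebra_simps)
    also have "\<dots> = coeff (smult \<beta> (lagP \<beta> (Suc k))) j"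
      unfolding Suc coeff_smult coeff_lagP e2 e4 using nz by (simp add: divide_simps)
    finally show ?thesis .
  qed
qed

text \<open>In the classical normalisation, with \<alpha> = \<beta> - 1, summing L_k^(\<alpha>) over
  k \<le> K gives L_K^(\<alpha>+1). Partial sums thus collapse to one Laguerre polynomial.\<close>

lemma sum_lagP:
  assumes "\<beta> > 0"
  shows "(\<Sum>k\<le>K. smult (pochhammer \<beta> k / fact k) (lagP \<beta> k)) = smult (pochhammer (\<beta> + 1) K / fact K) (lagP (\<beta> + 1) K)"
proof (induction K)
  case (Suc K)
  have "smult (pochhammer (\<beta> + 1) K / fact K) (lagP (\<beta> + 1) K) + smult (pochhammer \<beta> (Suc K) / fact (Suc K)) (lagP \<beta> (Suc K))
        = smult (pochhammer (\<beta> + 1) (Suc K) / fact (Suc K)) (lagP (\<beta> + 1) (Suc K))" (is "?l = ?r")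
  proof (rule poly_eqI)
    fix j
    define a where "a = pochhammer (- real (Suc K)) j"
    define b where "b = pochhammer (- real K) j"
    \<comment> \<open>Absorption expresses both Pochhammer symbols through \<open>a\<close>; the
      induction step then reduces to (K + 1 - j) + (\<beta> + j) = \<beta> + 1 + K.\<close>
    have ab: "(real K + 1 - real j) * a = (real K + 1) * b"
      using pochhammer_absorb_comp[of "real (Suc K)" j] by (simp add: a_def b_def algebra_simps)
    define p where "p = pochhammer (\<beta> + 1) K"
    define q where "q = pochhammer \<beta> j"
    have pq: "p > 0" "q > 0" using assms by (simp_all add: p_def q_def pochhammer_pos)
    have qj: "pochhammer (\<beta> + 1) j = q * (\<beta> + real j) / \<beta>"
      using pochhammer_Suc[of \<beta> j] pochhammer_rec[of \<beta> j] assms by (simp add: q_def field_simps)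
    have nz: "\<beta> + real j \<noteq> 0" "p \<noteq> 0" "\<beta> \<noteq> 0" "q \<noteq> 0" using assms pq by auto
    have "coeff ?l j = (p / (fact (Suc K) * q * fact j)) * (\<beta> / (\<beta> + real j)) * ((real K + 1) * b + (\<beta> + real j) * a)"
      unfolding coeff_add coeff_smult coeff_lagP a_def [symmetric] b_def [symmetric]
        pochhammer_rec[of \<beta> K] p_def[symmetric] q_def[symmetric] qj
      using nz by (simp add: divide_simps) (simp add: algebra_simps)
    also have "\<dots> = (p / (fact (Suc K) * q * fact j)) * (\<beta> / (\<beta> + real j)) * ((\<beta> + 1 + real K) * a)"
      unfolding ab[symmetric] by (simp add: algebra_simps)
    also have "\<dots> = coeff ?r j"
      unfolding coeff_add coeff_smult coeff_lagP a_def [symmetric] b_def [symmetric]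
        pochhammer_Suc[of "\<beta>+1" K] p_def[symmetric] q_def[symmetric] qj
      using nz by (simp add: divide_simps) 
    finally show "coeff ?l j = coeff ?r j" .
  qed
  then show ?case using Suc by simp
qed simp

subsection \<open>Integrals over the half-line\<close>

lemma Gamma_absolutely_integrable:
  assumes "s > (0::real)"
  shows "(\<lambda>t. t powr (s - 1) * exp (- t)) absolutely_integrable_on {0<..}"
    and "integral {0<..} (\<lambda>t. t powr (s - 1) * exp (- t)) = Gamma s"
proof -
  have "((\<lambda>t. t powr (s - 1) / exp t) has_integral Gamma s) {0..}"
    using Gamma_integral_real[OF assms] .
  hence "((\<lambda>t. t powr (s - 1) * exp (- t)) has_integral Gamma s) {0..}"
    by (simp add: exp_minus field_simps)
  hence "((\<lambda>t. if t \<in> {0<..} then t powr (s - 1) * exp (- t) else 0) has_integral Gamma s) {0..}"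
    by (rule has_integral_spike [of "{0}", rotated 2]) auto
  hence *: "((\<lambda>t. t powr (s - 1) * exp (- t)) has_integral Gamma s) {0<..}"
    by (subst (asm) has_integral_restrict) auto
  thus "integral {0<..} (\<lambda>t. t powr (s - 1) * exp (- t)) = Gamma s"
    by (rule integral_unique)
  show "(\<lambda>t. t powr (s - 1) * exp (- t)) absolutely_integrable_on {0<..}"
    using * by (intro nonnegative_absolutely_integrable_1) (auto simp: has_integral_integrable)
qed

text \<open>The substitution u = b t^r leads to the Gamma integral at s / r. This is the source of
  the Gamma values and fractional powers of 1 - c in the weights.\<close>

lemma Gamma_power_integral:
  assumes "s > (0::real)" "b > 0" "r > (0::nat)"
  shows "(\<lambda>t. t powr (s - 1) * exp (- (b * t ^ r))) absolutely_integrable_on {0<..}"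
    and "integral {0<..} (\<lambda>t. t powr (s - 1) * exp (- (b * t ^ r))) = Gamma (s / r) / (r * b powr (s / r))"
proof -
  let ?g = "\<lambda>t::real. b * t ^ r" and ?g' = "\<lambda>t::real. b * (real r * t ^ (r - 1))"
  let ?f = "\<lambda>u::real. u powr (s / r - 1) * exp (- u)"
  have im: "?g ` {0<..} = {0<..}"
  proof (intro equalityI subsetI)
    fix u :: real assume u: "u \<in> {0<..}"
    have "u = ?g (root r (u / b))" using assms u by (simp add: real_root_pow_pos)
    moreover have "root r (u / b) \<in> {0<..}" using assms u by simp
    ultimately show "u \<in> ?g ` {0<..}" by blast
  qed (use assms in auto)
  have inj: "inj_on ?g {0<..}"
    using assms by (auto simp: inj_on_def power_eq_iff_eq_base)
  have eq: "\<bar>?g' t\<bar> * ?f (?g t) = (r * b powr (s / r)) * (t powr (s - 1) * exp (- (b * t ^ r)))" if "t > 0" for t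
  proof -
    have "?g t powr (s / r - 1) = b powr (s / r - 1) * t powr (real r * (s / r - 1))"
      using that assms by (simp add: powr_mult powr_powr flip: powr_realpow)
    also have "b powr (s / r - 1) = b powr (s / r) / b"
      using assms by (simp add: powr_diff)
    also have "real r * (s / r - 1) = s - r" using assms by (simp add: field_simps)
    finally have e: "?g t powr (s / r - 1) = b powr (s / r) / b * t powr (s - r)" .
    have "t ^ (r - 1) * t powr (s - r) = t powr (s - 1)"
      using that assms by (simp add: powr_add [symmetric] of_nat_diff flip: powr_realpow)
    thus ?thesis unfolding e using assms that by (simp add: abs_mult field_simps)
  qed
  have "?f absolutely_integrable_on (?g ` {0<..}) \<and> integral (?g ` {0<..}) ?f = Gamma (s / r)"
    unfolding im using Gamma_absolutely_integrable[of "s / r"] assms by simp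
  hence "(\<lambda>t. \<bar>?g' t\<bar> * ?f (?g t)) absolutely_integrable_on {0<..} \<and>
          integral {0<..} (\<lambda>t. \<bar>?g' t\<bar> * ?f (?g t)) = Gamma (s / r)"
    by (subst has_absolute_integral_change_of_variables_1') 
       (use inj assms in \<open>auto intro!: derivative_eq_intros\<close>)
  also have "(\<lambda>t. \<bar>?g' t\<bar> * ?f (?g t)) absolutely_integrable_on {0<..} \<longleftrightarrow>
       (\<lambda>t. (r * b powr (s / r)) * (t powr (s - 1) * exp (- (b * t ^ r)))) absolutely_integrable_on {0<..}"
    by (intro set_integrable_cong) (use eq in auto)
  also have "integral {0<..} (\<lambda>t. \<bar>?g' t\<bar> * ?f (?g t)) = 
       integral {0<..} (\<lambda>t. (r * b powr (s / r)) * (t powr (s - 1) * exp (- (b * t ^ r))))"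
    by (intro integral_cong) (use eq in auto)
  finally have *: "(\<lambda>t. (r * b powr (s / r)) * (t powr (s - 1) * exp (- (b * t ^ r)))) absolutely_integrable_on {0<..}"
     "integral {0<..} (\<lambda>t. (r * b powr (s / r)) * (t powr (s - 1) * exp (- (b * t ^ r)))) = Gamma (s / r)"
    by auto
  have nz: "r * b powr (s / r) \<noteq> 0" using assms by simp
  from set_integrable_mult_right[OF *(1), of "1 / (r * b powr (s / r))"] nz
  show "(\<lambda>t. t powr (s - 1) * exp (- (b * t ^ r))) absolutely_integrable_on {0<..}"
    by simp
  from *(2) nz show "integral {0<..} (\<lambda>t. t powr (s - 1) * exp (- (b * t ^ r))) = Gamma (s / r) / (r * b powr (s / r))"
    by (simp only: integral_mult_right) (simp add: field_simps)
qed

lemma FTC_halfline: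
  fixes f F :: "real \<Rightarrow> real"
  assumes f: "f absolutely_integrable_on {0<..}" "continuous_on {0<..} f"
    and F: "\<And>t. t > 0 \<Longrightarrow> (F has_real_derivative f t) (at t)"
    and A: "(F \<longlongrightarrow> A) (at_right 0)" and B: "(F \<longlongrightarrow> B) at_top"
  shows "integral {0<..} f = B - A"
proof -
  \<comment> \<open>Absolute integrability refers to the completed Lebesgue measure, the interval
    integral to \<open>lborel\<close>. Continuity gives Borel measurability, under which the two
    integrals agree.\<close>
  have m: "(\<lambda>t. indicat_real {0<..} t *\<^sub>R f t) \<in> borel_measurable borel"
    using borel_measurable_continuous_on_indicator[OF _ f(2)] by simp
  have i: "set_integrable lborel {0<..} f"
    using f(1) m unfolding set_integrable_def by (simp add: integrable_completion)
  have "(LBINT x=ereal 0..\<infinity>. f x) = B - A"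
  proof (rule interval_integral_FTC_integrable)
    show "((F \<circ> real_of_ereal) \<longlongrightarrow> A) (at_right (ereal 0))"
      using A by (simp add: ereal_tendsto_simps)
    show "((F \<circ> real_of_ereal) \<longlongrightarrow> B) (at_left \<infinity>)"
      using B by (simp add: ereal_tendsto_simps)
    show "isCont f x" if "ereal 0 < ereal x" for x
      using f(2) that by (simp add: continuous_on_eq_continuous_at)
  qed (use i F in \<open>auto simp: has_real_derivative_iff_has_vector_derivative\<close>)
  also have "(LBINT x=ereal 0..\<infinity>. f x) = (LBINT x:{0<..}. f x)"
    by (simp add: interval_lebesgue_integral_def)
  also have "\<dots> = (LINT x:{0<..}|lebesgue. f x)"
    using m unfolding set_lebesgue_integral_def by (simp add: integral_completion)
  also have "\<dots> = integral {0<..} f"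
    using f(1) by (rule set_lebesgue_integral_eq_integral)
  finally show ?thesis by simp
qed

text \<open>\<open>H n\<close> plays the role of the \<open>n\<close>-th derivative of \<open>H 0\<close>.\<close>

definition bdd_smooth :: "(nat \<Rightarrow> real \<Rightarrow> real) \<Rightarrow> bool" where
  "bdd_smooth H \<longleftrightarrow>
     (\<forall>n. \<forall>t>0. (H n has_real_derivative H (Suc n) t) (at t)) \<and>
     (\<forall>n. \<exists>C. \<forall>t>0. \<bar>H n t\<bar> \<le> C)"

definition lagW :: "real \<Rightarrow> nat \<Rightarrow> (real \<Rightarrow> real) \<Rightarrow> real" where
  "lagW \<beta> k g = integral {0<..} (\<lambda>t. t powr (\<beta> - 1) * exp (- t) * poly (lagP \<beta> k) t * g t)"

lemma bdd_smooth_shift: "bdd_smooth H \<Longrightarrow> bdd_smooth (\<lambda>n. H (n + p))"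
  unfolding bdd_smooth_def by auto

lemma bdd_smooth_continuous: "bdd_smooth H \<Longrightarrow> continuous_on {0<..} (H n)"
  unfolding bdd_smooth_def
  by (meson DERIV_isCont continuous_at_imp_continuous_on greaterThan_iff)

lemma poly_altdef_le:
  fixes p :: "'a::comm_semiring_1 poly"
  assumes "degree p \<le> n"
  shows "poly p x = (\<Sum>j\<le>n. coeff p j * x ^ j)"
  unfolding poly_altdef by (rule sum.mono_neutral_left) (use assms in \<open>auto simp: coeff_eq_0\<close>)

lemma gamma_weight_integrable_bdd:
  fixes \<beta> :: real and h :: "real \<Rightarrow> real"
  assumes "\<beta> > 0" "continuous_on {0<..} h" "\<And>t. t > 0 \<Longrightarrow> \<bar>h t\<bar> \<le> C"
  shows "(\<lambda>t. t powr (\<beta> - 1) * exp (- t) * poly q t * h t) absolutely_integrable_on {0<..}"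
proof -
  have *: "(\<lambda>t. h t * (t powr (\<beta> + real j - 1) * exp (- t))) absolutely_integrable_on {0<..}" for j
    by (rule absolutely_integrable_bounded_measurable_product_real)
       (use assms in \<open>auto intro!: continuous_imp_measurable_on_sets_lebesgue boundedI Gamma_absolutely_integrable\<close>)
  have "(\<lambda>t. \<Sum>j\<le>degree q. coeff q j * (h t * (t powr (\<beta> + real j - 1) * exp (- t)))) absolutely_integrable_on {0<..}"
    by (intro absolutely_integrable_sum set_integrable_mult_right *) auto
  also have "?this \<longleftrightarrow> ?thesis"
  proof (intro set_integrable_cong refl)
    fix t :: real assume "t \<in> {0<..}"
    hence e: "t powr (\<beta> + real j - 1) = t powr (\<beta> - 1) * t ^ j" for j
      by (simp add: powr_add [symmetric] algebra_simps flip: powr_realpow)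
    show "(\<Sum>j\<le>degree q. coeff q j * (h t * (t powr (\<beta> + real j - 1) * exp (- t)))) = 
         t powr (\<beta> - 1) * exp (- t) * poly q t * h t"
      unfolding e poly_altdef by (simp add: sum_distrib_left sum_distrib_right mult_ac)
  qed
  finally show ?thesis .
qed

lemma gamma_weight_integrable:
  "(\<beta>::real) > 0 \<Longrightarrow> (\<lambda>t. t powr (\<beta> - 1) * exp (- t) * poly q t) absolutely_integrable_on {0<..}"
  using gamma_weight_integrable_bdd[where h = "\<lambda>_. 1" and C = 1] by simp

lemma integral_gamma_weight_poly:
  assumes "\<beta> > 0" "degree q \<le> n"
  shows "integral {0<..} (\<lambda>t. t powr (\<beta> - 1) * exp (- t) * poly q t) = (\<Sum>j\<le>n. coeff q j * Gamma (\<beta> + real j))"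
proof -
  have "integral {0<..} (\<lambda>t. t powr (\<beta> - 1) * exp (- t) * poly q t) =
        integral {0<..} (\<lambda>t. \<Sum>j\<le>n. coeff q j * (t powr (\<beta> + real j - 1) * exp (- t)))"
  proof (intro integral_cong)
    fix t :: real assume "t \<in> {0<..}"
    hence e: "t powr (\<beta> + real j - 1) = t powr (\<beta> - 1) * t ^ j" for j
      by (simp add: powr_add [symmetric] algebra_simps flip: powr_realpow)
    show "t powr (\<beta> - 1) * exp (- t) * poly q t = (\<Sum>j\<le>n. coeff q j * (t powr (\<beta> + real j - 1) * exp (- t)))"
      unfolding e poly_altdef_le[OF assms(2)] by (simp add: sum_distrib_left sum_distrib_right mult_ac)
  qed
  also have "\<dots> = (\<Sum>j\<le>n. integral {0<..} (\<lambda>t. coeff q j * (t powr (\<beta> + real j - 1) * exp (- t))))"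
    by (intro integral_sum set_lebesgue_integral_eq_integral(1) set_integrable_mult_right
         Gamma_absolutely_integrable) (use assms in auto)
  also have "\<dots> = (\<Sum>j\<le>n. coeff q j * Gamma (\<beta> + real j))"
    using assms by (simp add: Gamma_absolutely_integrable)
  finally show ?thesis .
qed

section \<open>Moments and norms of the Laguerre polynomials\<close>

lemma Gamma_plus_nat: "(\<beta>::real) > 0 \<Longrightarrow> Gamma (\<beta> + real n) = Gamma \<beta> * pochhammer \<beta> n"
  using pochhammer_Gamma[of \<beta> n] Gamma_real_pos[of \<beta>] nonpos_Ints_nonpos[of \<beta>]
  by (cases "\<beta> \<in> \<int>\<^sub>\<le>\<^sub>0") (auto simp: Gamma_eq_zero_iff)

text \<open>Termwise integration gives a terminating 2F1 at 1, evaluated by Chu-Vandermonde. The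
  factor (-l)_k vanishes for l < k, which is the orthogonality to lower powers.\<close>

lemma integral_lagP_power:
  assumes "\<beta> > 0"
  shows "integral {0<..} (\<lambda>t. t powr (\<beta> - 1) * exp (- t) * poly (monom 1 l * lagP \<beta> k) t) 
           = Gamma (\<beta> + real l) * pochhammer (- real l) k / pochhammer \<beta> k"
proof -
  have "integral {0<..} (\<lambda>t. t powr (\<beta> - 1) * exp (- t) * poly (monom 1 l * lagP \<beta> k) t) =
        integral {0<..} (\<lambda>t. t powr (\<beta> + real l - 1) * exp (- t) * poly (lagP \<beta> k) t)"
    by (intro integral_cong)
       (auto simp: poly_monom powr_add [symmetric] algebra_simps simp flip: powr_realpow)
  also have "\<dots> = (\<Sum>j\<le>k. coeff (lagP \<beta> k) j * Gamma (\<beta> + real l + real j))"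
    by (rule integral_gamma_weight_poly) (use assms degree_lagP_le in auto)
  also have "\<dots> = Gamma (\<beta> + real l) * (\<Sum>j=0..k. (pochhammer (\<beta> + real l) j * pochhammer (- (of_nat k)) j) /
                       (of_nat (fact j) * pochhammer \<beta> j))"
    using assms by (simp add: sum_distrib_left coeff_lagP Gamma_plus_nat[of "\<beta> + real l"] atMost_atLeast0 mult_ac)
  also have "(\<Sum>j=0..k. (pochhammer (\<beta> + real l) j * pochhammer (- (of_nat k)) j) /
                       (of_nat (fact j) * pochhammer \<beta> j)) = pochhammer (\<beta> - (\<beta> + real l)) k / pochhammer \<beta> k"
    by (rule Vandermonde_pochhammer) (use assms in auto)
  finally show ?thesis by simp
qed

lemma integral_lagP_sq:
  assumes "\<beta> > 0"
  shows "integral {0<..} (\<lambda>t. t powr (\<beta> - 1) * exp (- t) * poly (lagP \<beta> k) t ^ 2) = Gamma \<beta> * fact k / pochhammer \<beta> k"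
proof -
  have "integral {0<..} (\<lambda>t. t powr (\<beta> - 1) * exp (- t) * poly (lagP \<beta> k) t ^ 2) =
        integral {0<..} (\<lambda>t. \<Sum>l\<le>k. coeff (lagP \<beta> k) l * (t powr (\<beta> - 1) * exp (- t) * poly (monom 1 l * lagP \<beta> k) t))"
  proof (intro integral_cong)
    fix t :: real
    show "t powr (\<beta> - 1) * exp (- t) * poly (lagP \<beta> k) t ^ 2 =
        (\<Sum>l\<le>k. coeff (lagP \<beta> k) l * (t powr (\<beta> - 1) * exp (- t) * poly (monom 1 l * lagP \<beta> k) t))"
      unfolding power2_eq_square poly_mult poly_monom
      by (subst poly_altdef_le[OF degree_lagP_le]) (simp add: sum_distrib_left sum_distrib_right mult_ac)
  qed
  also have "\<dots> = (\<Sum>l\<le>k. coeff (lagP \<beta> k) l * (Gamma (\<beta> + real l) * pochhammer (- real l) k / pochhammer \<beta> k))"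
    by (subst integral_sum; (intro set_lebesgue_integral_eq_integral(1) set_integrable_mult_right gamma_weight_integrable)?)
       (use assms integral_lagP_power in auto)
  \<comment> \<open>By orthogonality only the leading power l = k contributes.\<close>
  also have "\<dots> = (\<Sum>l\<in>{k}. coeff (lagP \<beta> k) l * (Gamma (\<beta> + real l) * pochhammer (- real l) k / pochhammer \<beta> k))"
    by (rule sum.mono_neutral_right) (auto simp: pochhammer_of_nat_eq_0_iff)
  also have "\<dots> = Gamma \<beta> * fact k / pochhammer \<beta> k"
    using assms pochhammer_pos[OF assms, of k]
    by (simp add: coeff_lagP pochhammer_same Gamma_plus_nat field_simps power2_eq_square flip: power_mult_distrib)
  finally show ?thesis .
qed

lemma integral_lagP:
  assumes "\<beta> > 0"
  shows "integral {0<..} (\<lambda>t. t powr (\<beta> - 1) * exp (- t) * poly (lagP \<beta> k) t) = (if k = 0 then Gamma \<beta> else 0)"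
  using integral_lagP_power[OF assms, of 0 k] by (simp add: pochhammer_0_left)

text \<open>AM-GM in the form \<open>2 |P| \<le> N + P\<^sup>2 / N\<close> replaces the Cauchy-Schwarz inequality.\<close>

lemma lagW_bound:
  assumes \<beta>: "\<beta> > 0" and h: "continuous_on {0<..} h" "\<And>t. t > 0 \<Longrightarrow> \<bar>h t\<bar> \<le> C"
  shows "\<bar>lagW \<beta> k h\<bar> \<le> C * Gamma \<beta> * sqrt (fact k / pochhammer \<beta> k)"
proof -
  \<comment> \<open>\<open>N\<close> is the root mean square of P_k under the weight scaled to total
    mass 1, so both terms of the AM-GM bound contribute equally.\<close>
  define N where "N = sqrt (fact k / pochhammer \<beta> k)"
  have N: "N > 0" "N ^ 2 = fact k / pochhammer \<beta> k"
    using pochhammer_pos[OF \<beta>, of k] by (simp_all add: N_def)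
  have C: "C \<ge> 0" using h(2)[of 1] by linarith
  let ?w = "\<lambda>t. t powr (\<beta> - 1) * exp (- t)"
  let ?P = "lagP \<beta> k"
  have "\<bar>lagW \<beta> k h\<bar> \<le> integral {0<..} (\<lambda>t. (C / 2 * N) * (?w t * poly 1 t) + (C / (2 * N)) * (?w t * poly (?P ^ 2) t))"
    unfolding lagW_def real_norm_def [symmetric]
  proof (rule integral_norm_bound_integral)
    show "(\<lambda>t. ?w t * poly ?P t * h t) integrable_on {0<..}"
      by (intro set_lebesgue_integral_eq_integral(1) gamma_weight_integrable_bdd[where C = C] assms)
    show "(\<lambda>t. (C / 2 * N) * (?w t * poly 1 t) + (C / (2 * N)) * (?w t * poly (?P ^ 2) t)) integrable_on {0<..}"
      by (intro set_lebesgue_integral_eq_integral(1) set_integral_add set_integrable_mult_right gamma_weight_integrable assms)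
    fix t :: real assume t: "t \<in> {0<..}"
    have "0 \<le> (\<bar>poly ?P t\<bar> - N) ^ 2" by simp
    hence "\<bar>poly ?P t\<bar> * (2 * N) \<le> N ^ 2 + poly ?P t ^ 2"
      by (simp add: power2_eq_square algebra_simps)
    hence p: "\<bar>poly ?P t\<bar> \<le> (N ^ 2 + poly ?P t ^ 2) / (2 * N)"
      using N by (simp add: pos_le_divide_eq)
    have "norm (?w t * poly ?P t * h t) = ?w t * \<bar>poly ?P t\<bar> * \<bar>h t\<bar>"
      by (simp add: abs_mult)
    also have "\<dots> \<le> ?w t * ((N ^ 2 + poly ?P t ^ 2) / (2 * N)) * C"
      using p h(2)[of t] t N by (intro mult_mono mult_nonneg_nonneg) auto
    also have "\<dots> = (C / 2 * N) * (?w t * poly 1 t) + (C / (2 * N)) * (?w t * poly (?P ^ 2) t)"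
      using N(1) by (simp add: field_simps power2_eq_square)
    finally show "norm (?w t * poly ?P t * h t) \<le> \<dots>" .
  qed
  also have "\<dots> = (C / 2 * N) * Gamma \<beta> + (C / (2 * N)) * (Gamma \<beta> * fact k / pochhammer \<beta> k)"
    using \<beta> integral_lagP_sq[OF \<beta>, of k] integral_lagP[OF \<beta>, of 0]
    by (subst integral_add; (intro set_lebesgue_integral_eq_integral(1) set_integrable_mult_right gamma_weight_integrable)?)
       auto
  also have "Gamma \<beta> * fact k / pochhammer \<beta> k = Gamma \<beta> * N ^ 2" using N by simp
  also have "(C / 2 * N) * Gamma \<beta> + (C / (2 * N)) * (Gamma \<beta> * N ^ 2) = C * Gamma \<beta> * N"
    using N(1) by (simp add: field_simps power2_eq_square)
  finally show ?thesis unfolding N_def .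
qed

section \<open>Integration by parts and decay in k\<close>

lemma powr_exp_poly_tendsto_0_at_top: 
  "((\<lambda>t::real. t powr \<beta> * exp (- t) * poly q t) \<longlongrightarrow> 0) at_top"
proof -
  have "((\<lambda>t::real. \<Sum>j\<le>degree q. coeff q j * (t powr \<beta> * exp (- t) * t ^ j)) \<longlongrightarrow> (\<Sum>j\<le>degree q. coeff q j * 0)) at_top"
    by (intro tendsto_intros; real_asymp)
  thus ?thesis unfolding poly_altdef by (simp add: sum_distrib_left mult_ac)
qed

lemma tendsto_0_mult_bdd:
  fixes f h :: "'a \<Rightarrow> real"
  assumes "(f \<longlongrightarrow> 0) F" "eventually (\<lambda>t. \<bar>h t\<bar> \<le> C) F"
  shows "((\<lambda>t. f t * h t) \<longlongrightarrow> 0) F"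
proof (rule Lim_null_comparison)
  show "((\<lambda>t. \<bar>f t\<bar> * C) \<longlongrightarrow> 0) F"
    using tendsto_mult_left_zero[OF tendsto_rabs_zero[OF assms(1)]] .
  show "eventually (\<lambda>t. norm (f t * h t) \<le> \<bar>f t\<bar> * C) F"
    using assms(2) by eventually_elim (simp add: abs_mult mult_left_mono)
qed

text \<open>Integration by parts: \<open>?F\<close> tends to 0 at infinity because of the
  exponential and at 0 because \<beta> > 0, so its derivative has integral 0. By the Rodrigues step
  that derivative is the sum of the two integrands, the first one times \<beta>.\<close>

lemma lagW_Suc:
  assumes \<beta>: "\<beta> > 0" and H: "bdd_smooth H"
  shows "lagW \<beta> (Suc k) (H 0) = - lagW (\<beta> + 1) k (H 1) / \<beta>"
proof -
  let ?p = "lagP (\<beta> + 1) k"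
  let ?a = "\<lambda>t. t powr (\<beta> - 1) * exp (- t) * poly (lagP \<beta> (Suc k)) t * H 0 t"
  let ?b = "\<lambda>t. t powr ((\<beta> + 1) - 1) * exp (- t) * poly ?p t * H 1 t"
  let ?F = "\<lambda>t. t powr \<beta> * exp (- t) * poly ?p t * H 0 t"
  obtain C0 C1 where C: "\<And>t. t > 0 \<Longrightarrow> \<bar>H 0 t\<bar> \<le> C0" "\<And>t. t > 0 \<Longrightarrow> \<bar>H 1 t\<bar> \<le> C1"
    using H unfolding bdd_smooth_def by metis
  have ia: "?a absolutely_integrable_on {0<..}"
    using gamma_weight_integrable_bdd[OF \<beta> bdd_smooth_continuous[OF H] C(1)] by blast
  have ib: "?b absolutely_integrable_on {0<..}"
    using gamma_weight_integrable_bdd[OF _ bdd_smooth_continuous[OF H] C(2), of "\<beta> + 1"] \<beta> by simp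
  have pe: "\<beta> * poly ?p t + t * poly (pderiv ?p) t - t * poly ?p t = \<beta> * poly (lagP \<beta> (Suc k)) t" for t
    using arg_cong[OF lagP_Rodrigues_step[OF \<beta>, of k], of "\<lambda>q. poly q t"] by simp
  have "integral {0<..} (\<lambda>t. \<beta> * ?a t + ?b t) = 0 - 0"
  proof (rule FTC_halfline)
    show "(\<lambda>t. \<beta> * ?a t + ?b t) absolutely_integrable_on {0<..}"
      by (intro set_integral_add set_integrable_mult_right ia ib)
    show "continuous_on {0<..} (\<lambda>t. \<beta> * ?a t + ?b t)"
      by (intro continuous_intros bdd_smooth_continuous[OF H]) auto
    show "(?F has_real_derivative \<beta> * ?a t + ?b t) (at t)" if t: "t > 0" for t
    proof -
      have d: "(H 0 has_real_derivative H 1 t) (at t)"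
        using H t unfolding bdd_smooth_def by (metis One_nat_def)
      have tb: "t powr \<beta> = t powr (\<beta> - 1) * t"
        using t by (simp add: powr_diff)
      have "(?F has_real_derivative 
          (t powr (\<beta> - 1) * exp (- t) * (\<beta> * poly ?p t + t * poly (pderiv ?p) t - t * poly ?p t) * H 0 t
            + t powr \<beta> * exp (- t) * poly ?p t * H 1 t)) (at t)"
        using t by (auto intro!: derivative_eq_intros d simp: tb algebra_simps)
      thus ?thesis unfolding pe by (simp add: mult_ac)
    qed
    show "(?F \<longlongrightarrow> 0) at_top"
      by (rule tendsto_0_mult_bdd[OF powr_exp_poly_tendsto_0_at_top])
         (use C(1) in \<open>auto intro!: eventually_mono[OF eventually_gt_at_top[of 0]]\<close>)
    have "((\<lambda>t. t powr \<beta> * exp (- t) * poly ?p t) \<longlongrightarrow> 0 * exp (- 0) * poly ?p 0) (at_right 0)"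
      using \<beta> by (intro tendsto_intros; real_asymp?)
    hence "((\<lambda>t. t powr \<beta> * exp (- t) * poly ?p t) \<longlongrightarrow> 0) (at_right 0)" by simp
    thus "(?F \<longlongrightarrow> 0) (at_right 0)"
      by (rule tendsto_0_mult_bdd)
         (use C(1) in \<open>auto intro!: eventually_mono[OF eventually_at_right_less[of 0]]\<close>)
  qed
  also have "integral {0<..} (\<lambda>t. \<beta> * ?a t + ?b t) = \<beta> * lagW \<beta> (Suc k) (H 0) + lagW (\<beta> + 1) k (H 1)"
    unfolding lagW_def
    by (subst integral_add) (use ia ib in \<open>auto intro!: set_lebesgue_integral_eq_integral(1)\<close>)
  finally show ?thesis using \<beta> by (simp add: field_simps)
qed

lemma lagW_add:
  assumes "\<beta> > 0" "bdd_smooth H"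
  shows "lagW \<beta> (k + p) (H 0) = (- 1) ^ p / pochhammer \<beta> p * lagW (\<beta> + real p) k (H p)"
  using assms
proof (induction p arbitrary: \<beta> H)
  case (Suc p)
  have "lagW \<beta> (k + Suc p) (H 0) = - lagW (\<beta> + 1) (k + p) (H 1) / \<beta>"
    using lagW_Suc[OF Suc.prems] by simp
  also have "lagW (\<beta> + 1) (k + p) (H 1) = (- 1) ^ p / pochhammer (\<beta> + 1) p * lagW (\<beta> + 1 + real p) k (H (Suc p))"
    using Suc.IH[of "\<beta> + 1" "\<lambda>n. H (n + 1)"] Suc.prems bdd_smooth_shift[of H 1] by simp
  finally show ?case by (simp add: pochhammer_rec add_ac)
qed simp

text \<open>With k = m + p, integrating by parts p times and applying \<open>lagW_bound\<close>
  bounds the term by a constant times the square root of \<open>y m\<close>. As \<open>y m\<close>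
  has order m^(\<beta>-1-p), any p \<ge> \<beta> + 1 suffices.\<close>

lemma lagW_decay:
  assumes \<beta>: "\<beta> > 0" and H: "bdd_smooth H"
  shows "(\<lambda>k. pochhammer \<beta> k / fact k * lagW \<beta> k (H 0)) \<longlonglongrightarrow> 0"
proof -
  obtain p :: nat where p: "\<beta> + 1 \<le> real p" using real_arch_simple by blast
  define y where "y m = pochhammer \<beta> (m + p) * fact m / (fact (m + p)) ^ 2" for m
  have ypos: "y m \<ge> 0" for m using pochhammer_pos[OF \<beta>, of "m + p"] by (simp add: y_def)
  \<comment> \<open>The sequence (m + 1) \<open>y m\<close> is nonincreasing: the ratio of
    consecutive values is (m + 2)(\<beta> + m + p) / (m + p + 1)^2, which is at most 1 by \<beta>
    \<le> p - 1.\<close>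
  have ybd: "real (Suc m) * y m \<le> y 0" for m
  proof (induction m)
    case (Suc m)
    define s where "s = real m + real p + 1"
    have s: "s > 0" by (simp add: s_def)
    have "y (Suc m) = y m * ((\<beta> + real m + real p) * (real m + 1) / s ^ 2)"
      using s by (simp add: y_def s_def pochhammer_Suc add_ac power_mult_distrib mult_ac)
    hence "real (Suc (Suc m)) * y (Suc m) = (real (Suc m) * y m) * ((real m + 2) * (\<beta> + real m + real p) / s ^ 2)"
      by (simp add: mult_ac add_ac)
    also have "\<dots> \<le> (real (Suc m) * y m) * 1"
    proof (intro mult_left_mono)
      have "(real m + 2) * (\<beta> + real m + real p) \<le> (real m + 2) * (real m + 2 * real p - 1)"
        using p by (intro mult_left_mono) auto
      also have "\<dots> \<le> s ^ 2 - ((real p - 1) ^ 2 + 2 + real m)"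
        by (simp add: s_def power2_eq_square algebra_simps)
      also have "\<dots> \<le> s ^ 2" using zero_le_power2[of "real p - 1"] of_nat_0_le_iff[of m] by linarith
      finally show "(real m + 2) * (\<beta> + real m + real p) / s ^ 2 \<le> 1" using s by simp
    qed (use ypos in auto)
    finally show ?case using Suc by simp
  qed simp
  have y0: "y \<longlonglongrightarrow> 0"
  proof (rule tendsto_sandwich[where f = "\<lambda>_. 0"])
    show "eventually (\<lambda>m. y m \<le> y 0 / real (Suc m)) sequentially"
      using ybd by (intro always_eventually) (auto simp: field_simps)
    show "(\<lambda>m. y 0 / real (Suc m)) \<longlonglongrightarrow> 0" by real_asymp
  qed (use ypos in auto)
  obtain C where C: "\<And>t. t > 0 \<Longrightarrow> \<bar>H p t\<bar> \<le> C"
    using H unfolding bdd_smooth_def by metis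
  let ?P = "pochhammer \<beta> p"
  define D where "D = C * Gamma (\<beta> + real p) / ?P * sqrt ?P"
  have Pp: "?P > 0" using \<beta> by (rule pochhammer_pos)
  have "\<bar>pochhammer \<beta> (m + p) / fact (m + p) * lagW \<beta> (m + p) (H 0)\<bar> \<le> D * sqrt (y m)" for m
  proof -
    have pm: "pochhammer \<beta> (m + p) > 0" using \<beta> by (rule pochhammer_pos)
    have e: "pochhammer (\<beta> + real p) m = pochhammer \<beta> (m + p) / ?P"
      using pochhammer_product'[of \<beta> p m] Pp by (simp add: add_ac)
    have sq: "pochhammer \<beta> (m + p) = sqrt (pochhammer \<beta> (m + p)) * sqrt (pochhammer \<beta> (m + p))"
      using pm by simp
    have "\<bar>lagW \<beta> (m + p) (H 0)\<bar> = \<bar>lagW (\<beta> + real p) m (H p)\<bar> / ?P"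
      using lagW_add[OF \<beta> H, of m p] Pp by (simp add: abs_mult power_abs)
    also have "\<dots> \<le> C * Gamma (\<beta> + real p) * sqrt (fact m / pochhammer (\<beta> + real p) m) / ?P"
      by (intro divide_right_mono lagW_bound bdd_smooth_continuous[OF H] C) (use \<beta> Pp in auto)
    finally have "\<bar>pochhammer \<beta> (m + p) / fact (m + p) * lagW \<beta> (m + p) (H 0)\<bar> \<le>
       pochhammer \<beta> (m + p) / fact (m + p) * (C * Gamma (\<beta> + real p) * sqrt (fact m / pochhammer (\<beta> + real p) m) / ?P)"
      unfolding abs_mult using pm by (intro mult_mono) auto
    also have "\<dots> = D * (pochhammer \<beta> (m + p) / fact (m + p) * sqrt (fact m / pochhammer \<beta> (m + p)))"
      unfolding e D_def by (simp add: real_sqrt_divide real_sqrt_mult mult_ac)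
    also have "pochhammer \<beta> (m + p) / fact (m + p) * sqrt (fact m / pochhammer \<beta> (m + p)) = sqrt (y m)"
    proof -
      define x where "x = sqrt (pochhammer \<beta> (m + p))"
      have x: "x > 0" "pochhammer \<beta> (m + p) = x * x" using pm sq by (simp_all add: x_def)
      show ?thesis unfolding y_def x(2) using x(1) by (simp add: real_sqrt_divide real_sqrt_mult)
    qed
    finally show ?thesis .
  qed
  hence "eventually (\<lambda>m. norm (pochhammer \<beta> (m + p) / fact (m + p) * lagW \<beta> (m + p) (H 0)) \<le> D * sqrt (y m)) sequentially"
    unfolding real_norm_def by (intro always_eventually allI)
  moreover have "(\<lambda>m. D * sqrt (y m)) \<longlonglongrightarrow> 0"
    using tendsto_mult_right_zero[OF tendsto_real_sqrt[OF y0, simplified]] .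
  ultimately have "(\<lambda>m. pochhammer \<beta> (m + p) / fact (m + p) * lagW \<beta> (m + p) (H 0)) \<longlonglongrightarrow> 0"
    by (rule Lim_null_comparison)
  thus ?thesis by (rule LIMSEQ_offset)
qed

section \<open>Summation over k\<close>

text \<open>In contrast to \<open>bdd_smooth\<close>, the point 0 is included, since the sums below
  are Taylor data at 0. The quotient in the next lemma is only controlled for t > 0, where division
  by powers of t is meaningful.\<close>

definition bdd_smooth0 :: "(nat \<Rightarrow> real \<Rightarrow> real) \<Rightarrow> bool" where
  "bdd_smooth0 H \<longleftrightarrow>
     (\<forall>n t. (H n has_real_derivative H (Suc n) t) (at t)) \<and>
     (\<forall>n. \<exists>C. \<forall>t\<ge>0. \<bar>H n t\<bar> \<le> C)"

lemma bdd_smooth0_imp: "bdd_smooth0 H \<Longrightarrow> bdd_smooth H"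
  unfolding bdd_smooth_def bdd_smooth0_def by (meson less_imp_le)

lemma bdd_smooth0_shift: "bdd_smooth0 H \<Longrightarrow> bdd_smooth0 (\<lambda>n. H (n + p))"
  unfolding bdd_smooth0_def by auto

text \<open>The quotient is \<open>\<integral> H' (\<theta> t) d\<theta>\<close> over the unit interval, which makes all its derivatives bounded.\<close>

lemma bdd_smooth0_quotient:
  assumes "bdd_smooth0 H"
  obtains G where "bdd_smooth G" "\<And>t. t > 0 \<Longrightarrow> H 0 t = H 0 0 + t * G 0 t"
proof -
  have D: "(H n has_real_derivative H (Suc n) t) (at t within S)" for n t S
    using assms unfolding bdd_smooth0_def by (auto intro: DERIV_subset)
  have cont: "continuous_on S (H n)" for n S
    using D by (meson DERIV_continuous continuous_on_eq_continuous_within)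
  \<comment> \<open>Substituting s = \<theta> t shows that \<open>G n t\<close> is the integral of
    \<theta>^n \<open>H (Suc n)\<close> (\<theta> t) over the unit interval, i.e. the n-th
    derivative of \<open>G 0\<close>. A variable upper limit lets the fundamental theorem
    differentiate it.\<close>
  define I where "I n t = integral {0..t} (\<lambda>s. s ^ n * H (Suc n) s)" for n t
  define G where "G n t = I n t / t ^ Suc n" for n t
  have int: "(\<lambda>s. s ^ n * H (Suc n) s) integrable_on {0..t}" for n t
    by (intro integrable_continuous_interval continuous_intros cont)
  \<comment> \<open>This identity turns the quotient rule for \<open>G n\<close> into
    \<open>G (Suc n)\<close>.\<close>
  have parts: "real (Suc n) * I n t = t ^ Suc n * H (Suc n) t - I (Suc n) t" if "t > 0" for n t
  proof -
    have "((\<lambda>s. real (Suc n) * (s ^ n * H (Suc n) s) + s ^ Suc n * H (Suc (Suc n)) s) has_integral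
            (t ^ Suc n * H (Suc n) t - 0 ^ Suc n * H (Suc n) 0)) {0..t}"
    proof (rule fundamental_theorem_of_calculus)
      show "((\<lambda>s. s ^ Suc n * H (Suc n) s) has_vector_derivative
               real (Suc n) * (s ^ n * H (Suc n) s) + s ^ Suc n * H (Suc (Suc n)) s) (at s within {0..t})" for s
        unfolding has_real_derivative_iff_has_vector_derivative[symmetric]
        using DERIV_mult[OF DERIV_power[OF DERIV_ident, where n = "Suc n"] D[of "Suc n" s]]
        by (simp add: mult_ac del: power_Suc)
    qed (use that in auto)
    moreover have "((\<lambda>s. real (Suc n) * (s ^ n * H (Suc n) s) + s ^ Suc n * H (Suc (Suc n)) s) has_integral
            (real (Suc n) * I n t + I (Suc n) t)) {0..t}"
      unfolding I_def by (intro has_integral_add has_integral_mult_right integrable_integral int)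
    ultimately show ?thesis by (auto dest: has_integral_unique)
  qed
  have "bdd_smooth G"
    unfolding bdd_smooth_def
  proof (intro conjI allI impI)
    fix n and t :: real assume t: "t > 0"
    have "(I n has_real_derivative t ^ n * H (Suc n) t) (at t within {0..t+1})"
      unfolding I_def by (rule integral_has_real_derivative) (use t in \<open>auto intro!: continuous_intros cont\<close>)
    hence dI: "(I n has_real_derivative t ^ n * H (Suc n) t) (at t)"
      using t by (simp add: at_within_Icc_at)
    have "(G n has_real_derivative (t ^ n * H (Suc n) t * t ^ Suc n - I n t * (real (Suc n) * t ^ n)) / (t ^ Suc n * t ^ Suc n)) (at t)"
      unfolding G_def using t DERIV_divide[OF dI DERIV_power[OF DERIV_ident, where n = "Suc n"]]
      by (simp del: power_Suc)
    also have "I n t * (real (Suc n) * t ^ n) = t ^ n * (t ^ Suc n * H (Suc n) t - I (Suc n) t)"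
      unfolding parts[OF t, symmetric] by simp
    also have "(t ^ n * H (Suc n) t * t ^ Suc n - t ^ n * (t ^ Suc n * H (Suc n) t - I (Suc n) t)) / (t ^ Suc n * t ^ Suc n) = G (Suc n) t"
      unfolding G_def using t by (simp add: field_simps)
    finally show "(G n has_real_derivative G (Suc n) t) (at t)" .
  next
    fix n
    obtain C where C: "\<And>t. t \<ge> 0 \<Longrightarrow> \<bar>H (Suc n) t\<bar> \<le> C"
      using assms unfolding bdd_smooth0_def by meson
    show "\<exists>C. \<forall>t>0. \<bar>G n t\<bar> \<le> C"
    proof (intro exI allI impI)
      fix t :: real assume t: "t > 0"
      have "norm (I n t) \<le> (t ^ n * C) * (t - 0)"
        unfolding I_def
      proof (rule integral_bound)
        show "norm (s ^ n * H (Suc n) s) \<le> t ^ n * C" if "s \<in> {0..t}" for s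
          using that C[of s] by (auto simp: abs_mult intro!: mult_mono power_mono)
      qed (use t in \<open>auto intro!: continuous_intros cont\<close>)
      thus "\<bar>G n t\<bar> \<le> C" using t by (simp add: G_def abs_mult field_simps)
    qed
  qed
  moreover have "H 0 t = H 0 0 + t * G 0 t" if t: "t > 0" for t
  proof -
    have "(H 1 has_integral (H 0 t - H 0 0)) {0..t}"
      by (rule fundamental_theorem_of_calculus)
         (use t D[of 0] in \<open>auto simp: has_real_derivative_iff_has_vector_derivative[symmetric]\<close>)
    thus ?thesis using t by (simp add: G_def I_def integral_unique)
  qed
  ultimately show ?thesis by (rule that)
qed

text \<open>By \<open>sum_lagP\<close> a partial sum is a single integral against
  \<open>lagP (\<beta> + 1) K\<close>. Splitting H(t) = H(0) + t G(t), the constant contributes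
  exactly \<Gamma>(\<beta>) H(0) for every K, and the rest decays.\<close>

lemma lagW_sums:
  assumes \<beta>: "\<beta> > 0" and H: "bdd_smooth0 H"
  shows "(\<lambda>k. pochhammer \<beta> k / fact k * lagW \<beta> k (H 0)) sums (Gamma \<beta> * H 0 0)"
proof -
  let ?w = "\<lambda>t::real. t powr (\<beta> - 1) * exp (- t)"
  obtain G where G: "bdd_smooth G" "\<And>t. t > 0 \<Longrightarrow> H 0 t = H 0 0 + t * G 0 t"
    using bdd_smooth0_quotient[OF H] by blast
  obtain C CG where C: "\<And>t. t > 0 \<Longrightarrow> \<bar>H 0 t\<bar> \<le> C" "\<And>t. t > 0 \<Longrightarrow> \<bar>G 0 t\<bar> \<le> CG"
    using bdd_smooth0_imp[OF H] G(1) unfolding bdd_smooth_def by metis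
  have sum_eq: "(\<Sum>k\<le>K. pochhammer \<beta> k / fact k * integral {0<..} (\<lambda>t. ?w t * poly (lagP \<beta> k) t * h t)) =
        pochhammer (\<beta> + 1) K / fact K * integral {0<..} (\<lambda>t. ?w t * poly (lagP (\<beta> + 1) K) t * h t)"
    if h: "continuous_on {0<..} h" "\<And>t. t > 0 \<Longrightarrow> \<bar>h t\<bar> \<le> C" for h C K
  proof -
    have "(\<Sum>k\<le>K. pochhammer \<beta> k / fact k * integral {0<..} (\<lambda>t. ?w t * poly (lagP \<beta> k) t * h t)) =
          integral {0<..} (\<lambda>t. \<Sum>k\<le>K. pochhammer \<beta> k / fact k * (?w t * poly (lagP \<beta> k) t * h t))"
      by (subst integral_sum; (intro set_lebesgue_integral_eq_integral(1) set_integrable_mult_right gamma_weight_integrable_bdd[OF \<beta> h])?)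
         auto
    also have "(\<lambda>t. \<Sum>k\<le>K. pochhammer \<beta> k / fact k * (?w t * poly (lagP \<beta> k) t * h t)) = 
               (\<lambda>t. ?w t * poly (\<Sum>k\<le>K. smult (pochhammer \<beta> k / fact k) (lagP \<beta> k)) t * h t)"
      by (simp add: poly_sum sum_distrib_left sum_distrib_right mult_ac)
    also have "\<dots> = (\<lambda>t. pochhammer (\<beta> + 1) K / fact K * (?w t * poly (lagP (\<beta> + 1) K) t * h t))"
      unfolding sum_lagP[OF \<beta>] by (simp add: mult_ac)
    finally show ?thesis by (simp only: integral_mult_right)
  qed
  \<comment> \<open>With h = 1 in \<open>sum_eq\<close>, orthogonality leaves only k = 0.\<close>
  have one: "pochhammer (\<beta> + 1) K / fact K * integral {0<..} (\<lambda>t. ?w t * poly (lagP (\<beta> + 1) K) t) = Gamma \<beta>" for K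
    using sum_eq[of "\<lambda>_. 1" 1 K] by (simp add: integral_lagP[OF \<beta>] if_distrib sum.delta cong: if_cong)
  \<comment> \<open>The factor t in t G(t) raises the weight parameter to \<beta> + 1, matching the
    polynomial, so the remainder is again a \<open>lagW\<close> and \<open>lagW_decay\<close>
    applies.\<close>
  have part: "(\<Sum>k\<le>K. pochhammer \<beta> k / fact k * lagW \<beta> k (H 0)) = 
         Gamma \<beta> * H 0 0 + pochhammer (\<beta> + 1) K / fact K * lagW (\<beta> + 1) K (G 0)" for K
  proof -
    let ?P = "lagP (\<beta> + 1) K"
    have i2: "(\<lambda>t. t powr (\<beta> + 1 - 1) * exp (- t) * poly ?P t * G 0 t) integrable_on {0<..}"
      by (intro set_lebesgue_integral_eq_integral(1) gamma_weight_integrable_bdd[where C = CG] bdd_smooth_continuous G C)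
         (use \<beta> in auto)
    have i1: "(\<lambda>t. H 0 0 * (?w t * poly ?P t)) integrable_on {0<..}"
      by (intro set_lebesgue_integral_eq_integral(1) set_integrable_mult_right gamma_weight_integrable \<beta>)
    have "integral {0<..} (\<lambda>t. ?w t * poly ?P t * H 0 t) = 
      integral {0<..} (\<lambda>t. H 0 0 * (?w t * poly ?P t) + t powr (\<beta> + 1 - 1) * exp (- t) * poly ?P t * G 0 t)"
      by (intro integral_cong) (auto simp: G(2) powr_diff algebra_simps add_divide_distrib)
    also have "\<dots> = H 0 0 * integral {0<..} (\<lambda>t. ?w t * poly ?P t) + lagW (\<beta> + 1) K (G 0)"
      unfolding integral_add[OF i1 i2] lagW_def by simp
    finally have "pochhammer (\<beta> + 1) K / fact K * integral {0<..} (\<lambda>t. ?w t * poly ?P t * H 0 t) = 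
        H 0 0 * (pochhammer (\<beta> + 1) K / fact K * integral {0<..} (\<lambda>t. ?w t * poly ?P t))
          + pochhammer (\<beta> + 1) K / fact K * lagW (\<beta> + 1) K (G 0)"
      by (simp only:) (simp add: algebra_simps add_divide_distrib)
    moreover have "(\<Sum>k\<le>K. pochhammer \<beta> k / fact k * lagW \<beta> k (H 0)) = 
        pochhammer (\<beta> + 1) K / fact K * integral {0<..} (\<lambda>t. ?w t * poly ?P t * H 0 t)"
      unfolding lagW_def
      by (rule sum_eq) (use C(1) bdd_smooth_continuous[OF bdd_smooth0_imp[OF H]] in auto)
    ultimately show ?thesis unfolding one by simp
  qed
  have "(\<lambda>K. Gamma \<beta> * H 0 0 + pochhammer (\<beta> + 1) K / fact K * lagW (\<beta> + 1) K (G 0)) \<longlonglongrightarrow> Gamma \<beta> * H 0 0 + 0"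
    by (intro tendsto_intros lagW_decay[OF _ G(1)]) (use \<beta> in auto)
  thus ?thesis unfolding sums_def_le part by simp
qed

text \<open>Since (-k)_n vanishes for k < n, the sum starts at k = m + n. There n integrations by
  parts reduce it to \<open>lagW_sums\<close> for \<beta> + n and the n-th derivative; the signs and
  Pochhammer factors cancel.\<close>

lemma lagW_moment_sums:
  assumes \<beta>: "\<beta> > 0" and H: "bdd_smooth0 H"
  shows "(\<lambda>k. pochhammer (- real k) n * (pochhammer \<beta> k / fact k * lagW \<beta> k (H 0))) sums (Gamma (\<beta> + real n) * H n 0)"
proof -
  let ?f = "\<lambda>k. pochhammer (- real k) n * (pochhammer \<beta> k / fact k * lagW \<beta> k (H 0))"
  have "?f (m + n) = pochhammer (\<beta> + real n) m / fact m * lagW (\<beta> + real n) m (H n)" for m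
  proof -
    have P: "pochhammer \<beta> n > 0" using \<beta> by (rule pochhammer_pos)
    have e1: "pochhammer (- real (m + n)) n = (- 1) ^ n * pochhammer (real m + 1) n"
      using pochhammer_minus[of "real (m + n)" n] by simp
    have e2: "(fact (m + n) :: real) = fact m * pochhammer (real m + 1) n"
      using pochhammer_product'[of "1::real" m n] by (simp add: pochhammer_fact add_ac)
    have e3: "pochhammer \<beta> (m + n) = pochhammer \<beta> n * pochhammer (\<beta> + real n) m"
      using pochhammer_product'[of \<beta> n m] by (simp add: add_ac)
    have "pochhammer (real m + 1) n > 0" by (rule pochhammer_pos) simp
    moreover have "(- 1) ^ n * Q * (P * b / (f * Q) * ((- 1) ^ n / P * w)) = b / f * w"
      if "P > 0" "Q > 0" for P Q b f w :: real
    proof -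
      have "(- 1) ^ n * Q * (P * b / (f * Q) * ((- 1) ^ n / P * w)) = ((- 1) ^ n * (- 1) ^ n) * (b / f * w)"
        using that by simp
      thus ?thesis by (simp flip: power_mult_distrib)
    qed
    ultimately show ?thesis unfolding e1 e2 e3 lagW_add[OF \<beta> bdd_smooth0_imp[OF H]] using P
      by blast
  qed
  hence "(\<lambda>m. ?f (m + n)) sums (Gamma (\<beta> + real n) * H n 0)"
    using lagW_sums[OF _ bdd_smooth0_shift[OF H, of n], of "\<beta> + real n"] \<beta> by simp
  thus ?thesis
    by (subst (asm) sums_zero_iff_shift) (auto simp: pochhammer_of_nat_eq_0_iff)
qed

subsection \<open>The weights as Laguerre integrals\<close>

text \<open>Multiplication formula for Pochhammer symbols: raising m by one appends a block of r
  consecutive factors, each divided by r.\<close>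

lemma prod_list_Delta:
  assumes "r > 0"
  shows "(\<Prod>a\<leftarrow>Delta r z. pochhammer a m) = pochhammer z (r * m) / real r ^ (r * m)"
proof -
  have "(\<Prod>a\<leftarrow>Delta r z. pochhammer a m) = (\<Prod>j<r. pochhammer ((z + real j) / real r) m)"
    using prod.distinct_set_conv_list[of "[0..<r]" "\<lambda>j. pochhammer ((z + real j) / real r) m"]
    by (simp add: Delta_def o_def atLeast0LessThan)
  also have "\<dots> = pochhammer z (r * m) / real r ^ (r * m)"
  proof (induction m)
    case (Suc m)
    have "(\<Prod>j<r. pochhammer ((z + real j) / real r) (Suc m)) =
          (\<Prod>j<r. pochhammer ((z + real j) / real r) m) * (\<Prod>j<r. (z + real (r * m) + real j) / real r)"
      unfolding pochhammer_Suc prod.distrib using assms by (simp add: field_simps)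
    also have "(\<Prod>j<r. (z + real (r * m) + real j) / real r) = pochhammer (z + real (r * m)) r / real r ^ r"
      by (simp add: prod_dividef pochhammer_prod atLeast0LessThan)
    also have "(\<Prod>j<r. pochhammer ((z + real j) / real r) m) * (pochhammer (z + real (r * m)) r / real r ^ r)
        = pochhammer z (r * m + r) / real r ^ (r * m + r)"
      unfolding Suc pochhammer_product' by (simp add: power_add)
    finally show ?case by (simp add: add_ac)
  qed simp
  finally show ?thesis .
qed

text \<open>With \<open>j = r m + s\<close>, the sum over \<open>s < r\<close> of the series in \<open>m\<close> is a terminating sum over \<open>j\<close>
  split into residue classes modulo \<open>r\<close>. The series does not terminate for \<open>s > k\<close>, but then its prefactor vanishes.\<close>

definition wgtTerm :: "nat \<Rightarrow> real \<Rightarrow> real \<Rightarrow> nat \<Rightarrow> nat \<Rightarrow> nat \<Rightarrow> real" where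
  "wgtTerm r \<beta> c i k j = pochhammer (- real k) j / (pochhammer \<beta> j * fact j) *
      ((1 - c) powr (real j / real r) * Gamma ((\<beta> + real i + real j) / real r))"

lemma wgt_residue_class:
  assumes r: "r > 0" and \<beta>: "\<beta> > 0" and c: "c < 1"
  shows "pochhammer (- real k) s * (1 - c) powr (real s / real r) / (fact s * pochhammer \<beta> s)
               * Gamma ((\<beta> + real i + real s) / real r)
               * hypergeomF ([1] @ Delta r (- real k + real s) @ [(\<beta> + real s + real i) / real r])
                            (Delta r (\<beta> + real s) @ Delta r (real s + 1))
                            ((1 - c) / real r ^ r)
         = (\<Sum>m\<le>k. wgtTerm r \<beta> c i k (m * r + s))" (is "?A * ?G * ?h = _")
proof (cases "s \<le> k")
  case False
  hence "pochhammer (- real k) (m * r + s) = 0" for m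
    by (simp add: pochhammer_of_nat_eq_0_iff)
  moreover have "pochhammer (- real k) s = 0" using False by (simp add: pochhammer_of_nat_eq_0_iff)
  ultimately show ?thesis by (simp add: wgtTerm_def)
next
  case True
  let ?x = "(\<beta> + real s + real i) / real r"
  define t where "t m = pochhammer (- real k + real s) (r * m) * pochhammer ?x m * (1 - c) ^ m
                     / (pochhammer (\<beta> + real s) (r * m) * pochhammer (real s + 1) (r * m))" for m
  \<comment> \<open>The numerator parameter 1 cancels m!, and the powers of r from the three
    \<open>Delta\<close> lists cancel the one in the argument.\<close>
  have trm: "pochhammer 1 m * (P / R) * X / ((Q / R) * (S / R)) * ((1 - c) / real r ^ r) ^ m / fact m = P * X * (1 - c) ^ m / (Q * S)"
    if "R = real r ^ (r * m)" "Q > 0" "S > 0" for P Q R S X :: real and m :: nat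
  proof -
    have R: "R > 0" using r that by simp
    have e: "((1 - c) / real r ^ r) ^ m = (1 - c) ^ m / R"
      by (simp add: power_divide that power_mult)
    show ?thesis unfolding e pochhammer_fact[symmetric] using that(2,3) R by (simp add: field_simps)
  qed
  have "?h = (\<Sum>m. t m)"
    unfolding hypergeomF_def
  proof (intro arg_cong[where f = suminf] ext)
    fix m
    have "(\<Prod>a\<leftarrow>[1] @ Delta r (- real k + real s) @ [?x]. pochhammer a m) =
        pochhammer 1 m * (pochhammer (- real k + real s) (r * m) / real r ^ (r * m)) * pochhammer ?x m"
      by (simp add: prod_list_Delta[OF r])
    moreover have "(\<Prod>b\<leftarrow>Delta r (\<beta> + real s) @ Delta r (real s + 1). pochhammer b m) =
        (pochhammer (\<beta> + real s) (r * m) / real r ^ (r * m)) * (pochhammer (real s + 1) (r * m) / real r ^ (r * m))"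
      by (simp add: prod_list_Delta[OF r])
    ultimately show "(\<Prod>a\<leftarrow>[1] @ Delta r (- real k + real s) @ [?x]. pochhammer a m) /
        (\<Prod>b\<leftarrow>Delta r (\<beta> + real s) @ Delta r (real s + 1). pochhammer b m) *
        ((1 - c) / real r ^ r) ^ m / fact m = t m"
      unfolding t_def using \<beta> by (simp only:) (rule trm, auto intro!: pochhammer_pos)
  qed
  \<comment> \<open>The cutoff k is generous: already r m > k - s makes the Pochhammer symbol of s -
    k vanish.\<close>
  also have "\<dots> = (\<Sum>m\<le>k. t m)"
  proof (rule suminf_finite)
    fix m assume "m \<notin> {..k}"
    hence "k < m" by simp
    also have "m \<le> r * m" using r by simp
    finally have "k - s < r * m" by linarith
    hence "pochhammer (- real (k - s)) (r * m) = 0" by (simp add: pochhammer_of_nat_eq_0_iff)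
    thus "t m = 0" using True by (simp add: t_def of_nat_diff)
  qed simp
  also have "?A * ?G * (\<Sum>m\<le>k. t m) = (\<Sum>m\<le>k. wgtTerm r \<beta> c i k (m * r + s))"
    unfolding sum_distrib_left
  proof (intro sum.cong refl)
    fix m
    have e1: "pochhammer (- real k) (m * r + s) = pochhammer (- real k) s * pochhammer (- real k + real s) (r * m)"
      using pochhammer_product'[of "- real k" s "r * m"] by (simp add: add_ac mult_ac)
    have e2: "pochhammer \<beta> (m * r + s) = pochhammer \<beta> s * pochhammer (\<beta> + real s) (r * m)"
      using pochhammer_product'[of \<beta> s "r * m"] by (simp add: add_ac mult_ac)
    have e3: "(fact (m * r + s) :: real) = fact s * pochhammer (real s + 1) (r * m)"
      using pochhammer_product'[of "1::real" s "r * m"] by (simp add: pochhammer_fact add_ac mult_ac)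
    have "(1 - c) powr (real (m * r + s) / real r) = (1 - c) powr (real s / real r + real m)"
      using r by (simp add: field_simps)
    hence e4: "(1 - c) powr (real (m * r + s) / real r) = (1 - c) powr (real s / real r) * (1 - c) ^ m"
      using c by (simp add: powr_add powr_realpow)
    have "(\<beta> + real i + real (m * r + s)) / real r = ?x + real m"
      using r by (simp add: field_simps)
    hence e5: "Gamma ((\<beta> + real i + real (m * r + s)) / real r) = Gamma ((\<beta> + real i + real s) / real r) * pochhammer ?x m"
      using Gamma_plus_nat[of ?x m] \<beta> r by (simp add: add_ac)
    show "?A * ?G * t m = wgtTerm r \<beta> c i k (m * r + s)"
      unfolding wgtTerm_def t_def e1 e2 e3 e4 e5 by (simp add: mult_ac)
  qed
  finally show ?thesis .
qed

text \<open>The factor e^t of g cancels the e^(-t) of the Laguerre weight. Expanding P_k leaves the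
  integrals of \<open>Gamma_power_integral\<close> with s = \<beta> + i + j and b = 1 / (1 - c), and
  these are the summands \<open>wgtTerm\<close>.\<close>

lemma wgt_eq_lagW:
  assumes r: "r > 0" and \<beta>: "\<beta> > 0" and c: "c < 1"
  shows "wgt r \<beta> c i k = (-1) ^ i / (Gamma \<beta> * sqrt (fact i * pochhammer \<beta> i))
            * lagW \<beta> k (\<lambda>t. t ^ i * exp (t - 1 / (1 - c) * t ^ r))"
proof -
  let ?b = "1 / (1 - c)"
  have b: "?b > 0" using c by simp
  have "(\<Sum>s<r. \<Sum>m\<le>k. wgtTerm r \<beta> c i k (m * r + s)) = (\<Sum>m<Suc k. \<Sum>s<r. wgtTerm r \<beta> c i k (m * r + s))"
    by (subst sum.swap) (simp add: lessThan_Suc_atMost)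
  also have "\<dots> = (\<Sum>m<Suc k. sum (wgtTerm r \<beta> c i k) {m * r..<m * r + r})"
  proof (rule sum.cong)
    fix m
    show "(\<Sum>s<r. wgtTerm r \<beta> c i k (m * r + s)) = sum (wgtTerm r \<beta> c i k) {m * r..<m * r + r}"
      using sum.shift_bounds_nat_ivl[of "wgtTerm r \<beta> c i k" 0 "m * r" r]
      by (simp add: atLeast0LessThan add.commute)
  qed simp
  also have "\<dots> = (\<Sum>j<Suc k * r. wgtTerm r \<beta> c i k j)"
    by (rule sum.nat_group)
  \<comment> \<open>The blocks of length r overshoot k, but (-k)_j = 0 there.\<close>
  also have "\<dots> = (\<Sum>j\<le>k. wgtTerm r \<beta> c i k j)"
  proof (rule sum.mono_neutral_right)
    have "j < Suc k * r" if "j \<le> k" for j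
      using that r mult_le_mono[of "Suc k" "Suc k" 1 r] by simp
    thus "{..k} \<subseteq> {..<Suc k * r}" by auto
  qed (auto simp: wgtTerm_def pochhammer_of_nat_eq_0_iff)
  finally have s: "(\<Sum>s<r. \<Sum>m\<le>k. wgtTerm r \<beta> c i k (m * r + s)) = (\<Sum>j\<le>k. wgtTerm r \<beta> c i k j)" .
  have "lagW \<beta> k (\<lambda>t. t ^ i * exp (t - ?b * t ^ r)) = 
      integral {0<..} (\<lambda>t. \<Sum>j\<le>k. coeff (lagP \<beta> k) j * (t powr (\<beta> + real i + real j - 1) * exp (- (?b * t ^ r))))"
    unfolding lagW_def
  proof (intro integral_cong)
    fix t :: real assume t: "t \<in> {0<..}"
    have e: "t powr (\<beta> + real i + real j - 1) = t powr (\<beta> - 1) * t ^ i * t ^ j" for j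
      using t by (simp add: powr_add [symmetric] algebra_simps flip: powr_realpow)
    have e': "exp (t - ?b * t ^ r) = exp t * exp (- (?b * t ^ r))" 
      unfolding exp_add [symmetric] by simp
    have e'': "exp (- t) * exp t = 1" by (simp flip: exp_add)
    have "t powr (\<beta> - 1) * exp (- t) * poly (lagP \<beta> k) t * (t ^ i * exp (t - ?b * t ^ r))
       = (exp (- t) * exp t) * (t powr (\<beta> - 1) * t ^ i * poly (lagP \<beta> k) t * exp (- (?b * t ^ r)))"
      unfolding e' by (simp only: mult_ac)
    also have "\<dots> = (\<Sum>j\<le>k. coeff (lagP \<beta> k) j * (t powr (\<beta> + real i + real j - 1) * exp (- (?b * t ^ r))))"
      unfolding e'' e poly_altdef_le[OF degree_lagP_le] by (simp add: sum_distrib_left sum_distrib_right mult_ac)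
    finally show "t powr (\<beta> - 1) * exp (- t) * poly (lagP \<beta> k) t * (t ^ i * exp (t - ?b * t ^ r)) = \<dots>" .
  qed
  also have "\<dots> = (\<Sum>j\<le>k. integral {0<..} (\<lambda>t. coeff (lagP \<beta> k) j * (t powr (\<beta> + real i + real j - 1) * exp (- (?b * t ^ r)))))"
    by (intro integral_sum set_lebesgue_integral_eq_integral(1) set_integrable_mult_right Gamma_power_integral)
       (use \<beta> b r in auto)
  also have "\<dots> = (\<Sum>j\<le>k. coeff (lagP \<beta> k) j * (Gamma ((\<beta> + real i + real j) / r) / (r * ?b powr ((\<beta> + real i + real j) / r))))"
    unfolding integral_mult_right
    by (intro sum.cong refl, subst Gamma_power_integral(2)) (use \<beta> b r in auto)
  also have "\<dots> = (\<Sum>j\<le>k. (1 - c) powr ((\<beta> + real i) / r) / r * wgtTerm r \<beta> c i k j)"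
  proof (intro sum.cong refl)
    fix j
    have "1 / ?b powr ((\<beta> + real i + real j) / r) = (1 - c) powr ((\<beta> + real i) / r + real j / r)"
      using c by (simp add: powr_divide add_divide_distrib)
    also have "\<dots> = (1 - c) powr ((\<beta> + real i) / r) * (1 - c) powr (real j / r)"
      by (rule powr_add)
    finally have e: "1 / ?b powr ((\<beta> + real i + real j) / r) = \<dots>" .
    have "coeff (lagP \<beta> k) j * (Gamma ((\<beta> + real i + real j) / r) / (r * ?b powr ((\<beta> + real i + real j) / r)))
       = coeff (lagP \<beta> k) j * Gamma ((\<beta> + real i + real j) / r) / r * (1 / ?b powr ((\<beta> + real i + real j) / r))"
      by simp
    also have "\<dots> = (1 - c) powr ((\<beta> + real i) / r) / r * wgtTerm r \<beta> c i k j"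
      unfolding e wgtTerm_def coeff_lagP by (simp add: mult_ac)
    finally show "coeff (lagP \<beta> k) j * (Gamma ((\<beta> + real i + real j) / r) / (r * ?b powr ((\<beta> + real i + real j) / r))) = \<dots>" .
  qed
  finally have l: "lagW \<beta> k (\<lambda>t. t ^ i * exp (t - ?b * t ^ r)) = (1 - c) powr ((\<beta> + real i) / r) / r * (\<Sum>j\<le>k. wgtTerm r \<beta> c i k j)"
    by (simp only: sum_distrib_left)
  show ?thesis
    unfolding wgt_def wgt_residue_class[OF r \<beta> c] s l by (simp add: mult_ac)
qed

subsection \<open>The recurrence in terms of formal power series\<close>

text \<open>The series is exp(u z + v z^r), whose logarithmic derivative is the polynomial u + r v
  z^(r-1).\<close>

lemma fps_exp_oo_power_deriv:
  fixes u v :: real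
  assumes "r > 0"
  shows "fps_deriv (fps_exp u * (fps_exp v oo fps_X ^ r)) =
           fps_of_poly ([:u:] + monom (v * real r) (r - 1)) * (fps_exp u * (fps_exp v oo fps_X ^ r))"
proof -
  have "fps_deriv (fps_exp v oo fps_X ^ r) = (fps_const v * (fps_exp v oo fps_X ^ r)) * (of_nat r * fps_X ^ (r - 1))"
    using assms by (simp add: fps_compose_deriv fps_deriv_power fps_const_mult_apply_left fps_of_nat)
  moreover have "fps_of_poly ([:u:] + monom (v * real r) (r - 1)) = fps_const u + fps_const v * (of_nat r * fps_X ^ (r - 1))"
    by (simp add: fps_of_poly_add fps_of_poly_monom fps_of_poly_const fps_of_nat flip: fps_const_mult)
  ultimately show ?thesis by (simp add: algebra_simps)
qed

lemma fps_exp_oo_power_inverse: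
  fixes u v :: real
  assumes "r > 0"
  shows "(fps_exp u * (fps_exp v oo fps_X ^ r)) * (fps_exp (- u) * (fps_exp (- v) oo fps_X ^ r)) = 1"
proof -
  have "(fps_exp v oo fps_X ^ r) * (fps_exp (- v) oo fps_X ^ r) = (fps_exp v * fps_exp (- v)) oo fps_X ^ r"
    using assms by (subst fps_compose_mult_distrib) auto
  also have "\<dots> = 1" by (simp flip: fps_exp_add_mult)
  finally have "(fps_exp v oo fps_X ^ r) * (fps_exp (- v) oo fps_X ^ r) = 1" .
  moreover have "fps_exp u * fps_exp (- u) = (1 :: real fps)" by (simp flip: fps_exp_add_mult)
  ultimately show ?thesis by (simp add: mult_ac)
qed

text \<open>Replacing z by -z in exp(u z + v z^r) produces the sign (-1)^r, which explains that sign
  in \<open>expPart\<close>.\<close>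

lemma fps_exp_oo_power_reflect:
  fixes u v :: real
  assumes "r > 0"
  shows "fps_nth (fps_exp (- u) * (fps_exp ((-1) ^ r * v) oo fps_X ^ r)) n = (-1) ^ n * fps_nth (fps_exp u * (fps_exp v oo fps_X ^ r)) n"
proof -
  have e: "fps_nth (fps_exp ((-1) ^ r * v) oo fps_X ^ r) k = (-1) ^ k * fps_nth (fps_exp v oo fps_X ^ r) k" for k
    using assms by (auto simp: fps_nth_compose_X_power power_mult_distrib elim!: dvdE simp flip: power_mult)
  show ?thesis
    unfolding fps_mult_nth sum_distrib_left
  proof (intro sum.cong refl)
    fix j assume j: "j \<in> {0..n}"
    have "(- u) ^ j = (-1) ^ j * u ^ j" by (simp flip: power_mult_distrib)
    moreover have "(-1 :: real) ^ n = (-1) ^ j * (-1) ^ (n - j)" using j by (simp flip: power_add)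
    ultimately show "fps_exp (- u) $ j * (fps_exp ((-1) ^ r * v) oo fps_X ^ r) $ (n - j) =
          (-1) ^ n * (fps_exp u $ j * (fps_exp v oo fps_X ^ r) $ (n - j))"
      unfolding e by simp
  qed
qed

section \<open>Degree growth under the conjugated operator\<close>

lemma coeff_mult_degree_le:
  fixes p q :: "'a::comm_semiring_0 poly"
  assumes "degree p \<le> m" "degree q \<le> n"
  shows "coeff (p * q) (m + n) = coeff p m * coeff q n"
proof -
  have "coeff (p * q) (m + n) = (\<Sum>i\<le>m + n. coeff p i * coeff q (m + n - i))" by (rule coeff_mult)
  also have "\<dots> = (\<Sum>i\<in>{m}. coeff p i * coeff q (m + n - i))"
  proof (rule sum.mono_neutral_right)
    show "\<forall>i\<in>{..m + n} - {m}. coeff p i * coeff q (m + n - i) = 0"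
    proof
      fix i assume i: "i \<in> {..m + n} - {m}"
      show "coeff p i * coeff q (m + n - i) = 0"
        using i assms by (cases "i < m") (auto simp: coeff_eq_0)
    qed
  qed auto
  finally show ?thesis by simp
qed

text \<open>If \<open>B' = - \<phi> B\<close> then \<open>(B p)' = B (conjD \<phi> p)\<close>.\<close>

definition conjD :: "real poly \<Rightarrow> real poly \<Rightarrow> real poly" where
  "conjD \<phi> p = pderiv p - \<phi> * p"

definition lagPolyD :: "real \<Rightarrow> real poly \<Rightarrow> real poly \<Rightarrow> real poly" where
  "lagPolyD \<beta> \<phi> p = [:0, 1:] * (conjD \<phi> (conjD \<phi> p) + conjD \<phi> p) + smult \<beta> (conjD \<phi> p)"

lemma conjD_degree_le:
  assumes "degree \<phi> \<le> m" "degree p \<le> n"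
  shows "degree (conjD \<phi> p) \<le> m + n" and "coeff (conjD \<phi> p) (m + n) = - (coeff \<phi> m * coeff p n)"
proof -
  show "degree (conjD \<phi> p) \<le> m + n"
    unfolding conjD_def
    by (intro degree_diff_le) (use assms degree_mult_le[of \<phi> p] in \<open>auto simp: degree_pderiv\<close>)
  have "coeff (pderiv p) (m + n) = 0" using assms by (simp add: coeff_pderiv coeff_eq_0)
  thus "coeff (conjD \<phi> p) (m + n) = - (coeff \<phi> m * coeff p n)"
    using coeff_mult_degree_le[OF assms] by (simp add: conjD_def)
qed

text \<open>The top coefficient comes from z \<phi>^2 p. Only for m = 0 does the first-order term -z
  \<phi> p reach the same degree, giving \<phi>^2 - \<phi>; the second hypothesis excludes
  cancellation in both cases.\<close>

lemma degree_lagPolyD: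
  assumes "degree \<phi> \<le> m" "coeff \<phi> m ^ 2 \<noteq> (if m = 0 then coeff \<phi> m else 0)" "p \<noteq> 0"
  shows "degree (lagPolyD \<beta> \<phi> p) = degree p + (2 * m + 1)"
proof (rule antisym)
  define n where "n = degree p"
  note d1 = conjD_degree_le[OF assms(1), of p n, unfolded n_def, OF order_refl, folded n_def]
  note d2 = conjD_degree_le[OF assms(1) d1(1)]
  let ?q = "conjD \<phi> (conjD \<phi> p) + conjD \<phi> p"
  have dq: "degree ?q \<le> m + (m + n)" using d1 d2 by (intro degree_add_le) auto
  show "degree (lagPolyD \<beta> \<phi> p) \<le> degree p + (2 * m + 1)"
    unfolding lagPolyD_def
    by (intro degree_add_le order_trans[OF degree_mult_le] order_trans[OF degree_smult_le])
       (use d1(1) dq in \<open>auto simp: n_def\<close>)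
  have "coeff (conjD \<phi> p) (m + n + 1) = 0" "m > 0 \<Longrightarrow> coeff (conjD \<phi> p) (m + (m + n)) = 0"
    "coeff (conjD \<phi> p) (m + (m + n) + 1) = 0"
    using d1(1) by (auto intro!: coeff_eq_0)
  hence "coeff (lagPolyD \<beta> \<phi> p) (Suc (m + (m + n))) = (coeff \<phi> m ^ 2 - (if m = 0 then coeff \<phi> m else 0)) * coeff p n"
    using d1(2) d2(2)
    by (auto simp: lagPolyD_def coeff_pCons power2_eq_square left_diff_distrib)
  hence "coeff (lagPolyD \<beta> \<phi> p) (n + (2 * m + 1)) = (coeff \<phi> m ^ 2 - (if m = 0 then coeff \<phi> m else 0)) * coeff p n"
    by (simp add: mult_2 add_ac)
  also have "\<dots> \<noteq> 0" using assms by (simp add: n_def)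
  finally show "degree p + (2 * m + 1) \<le> degree (lagPolyD \<beta> \<phi> p)"
    by (intro le_degree) (simp add: n_def)
qed

definition lagFpsD :: "real \<Rightarrow> real fps \<Rightarrow> real fps" where
  "lagFpsD \<beta> f = fps_X * (fps_deriv (fps_deriv f) + fps_deriv f) + fps_const \<beta> * fps_deriv f"

lemma lagFpsD_conj:
  assumes "fps_deriv B = - (fps_of_poly \<phi> * B)"
  shows "lagFpsD \<beta> (B * fps_of_poly p) = B * fps_of_poly (lagPolyD \<beta> \<phi> p)"
proof -
  have d: "fps_deriv (B * fps_of_poly p) = B * fps_of_poly (conjD \<phi> p)" for p
    by (simp add: conjD_def assms fps_of_poly_diff fps_of_poly_mult fps_of_poly_pderiv algebra_simps)
  show ?thesis unfolding lagFpsD_def d lagPolyD_def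
    by (simp add: fps_of_poly_add fps_of_poly_mult fps_of_poly_smult fps_of_poly_pCons algebra_simps)
qed

text \<open>Coefficient form of the differential equation in z, obtained from x (-x)_k = k (-x)_k -
  (-x)_(k+1).\<close>

lemma hypPart_recurrence:
  assumes "\<beta> > 0"
  shows "[:0, 1:] * fps_nth (hypPart \<beta>) k =
     smult (real (Suc k) * (\<beta> + real k)) (fps_nth (hypPart \<beta>) (Suc k)) + smult (real k) (fps_nth (hypPart \<beta>) k)"
proof -
  let ?P = "pochhammer (- [:0, 1::real:]) k"
  have c: "real (Suc k) * (\<beta> + real k) * ((-1) ^ Suc k / (pochhammer \<beta> (Suc k) * fact (Suc k))) = - ((-1) ^ k / (pochhammer \<beta> k * fact k))"
  proof -
    have "x * y * (- 1 * u / (p * y * (x * f))) = - (u / (p * f))" if "x \<noteq> 0" "y \<noteq> 0" for x y u p f :: real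
      using that by simp
    thus ?thesis using assms unfolding pochhammer_Suc power_Suc fact_Suc by simp
  qed
  have q: "pochhammer (- [:0, 1::real:]) (Suc k) = smult (real k) ?P - [:0, 1:] * ?P"
    by (simp add: pochhammer_Suc of_nat_poly algebra_simps)
  show ?thesis unfolding hypPart_def fps_nth_Abs_fps smult_smult c q
    by (simp add: smult_diff_right mult_ac)
qed

lemma degree_hypPart:
  assumes "\<beta> > 0"
  shows "degree (fps_nth (hypPart \<beta>) k) = k"
proof -
  have "pochhammer (- [:0, 1::real:]) k \<noteq> 0 \<and> degree (pochhammer (- [:0, 1::real:]) k) = k"
  proof (induction k)
    case (Suc k)
    have e: "- [:0, 1::real:] + of_nat k = [:real k, -1:]" by (simp add: of_nat_poly)
    show ?case unfolding pochhammer_Suc e using Suc by (auto simp: degree_mult_eq simp del: mult_pCons_right)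
  qed simp
  moreover have "pochhammer \<beta> k \<noteq> 0" using pochhammer_pos[OF assms, of k] by simp
  ultimately show ?thesis by (simp add: hypPart_def)
qed

lemma genM_nth: "fps_nth (genM r \<beta> c) n = (\<Sum>j\<le>n. smult (fps_nth (expPart r c) j) (fps_nth (hypPart \<beta>) (n - j)))"
  by (simp add: genM_def fps_mult_nth atLeast0AtMost)

lemma genM_nth_lead:
  assumes "r > 0" "\<beta> > 0"
  shows "coeff (fps_nth (genM r \<beta> c) n) n \<noteq> 0"
proof -
  have "coeff (fps_nth (genM r \<beta> c) n) n = (\<Sum>j\<le>n. fps_nth (expPart r c) j * coeff (fps_nth (hypPart \<beta>) (n - j)) n)"
    by (simp add: genM_nth coeff_sum)
  \<comment> \<open>For j > 0 the polynomial has degree n - j < n; the constant coefficient of the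
    exponential factor is 1.\<close>
  also have "\<dots> = (\<Sum>j\<in>{0}. fps_nth (expPart r c) j * coeff (fps_nth (hypPart \<beta>) (n - j)) n)"
    by (rule sum.mono_neutral_right) (use assms in \<open>auto simp: degree_hypPart intro!: coeff_eq_0\<close>)
  also have "\<dots> = lead_coeff (fps_nth (hypPart \<beta>) n)"
    using assms by (simp add: expPart_def fps_nth_compose_X_power degree_hypPart)
  also have "\<dots> \<noteq> 0"
  proof -
    have "fps_nth (hypPart \<beta>) n \<noteq> 0"
    proof (cases n)
      case 0 thus ?thesis by (simp add: hypPart_def)
    next
      case (Suc m) thus ?thesis using degree_hypPart[OF assms(2), of n] by auto
    qed
    thus ?thesis by simp
  qed
  finally show ?thesis .
qed

lemma genM_nth_nonzero: "r > 0 \<Longrightarrow> \<beta> > 0 \<Longrightarrow> fps_nth (genM r \<beta> c) n \<noteq> 0"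
  using genM_nth_lead[of r \<beta> c n] by auto

lemma degree_genM:
  assumes "r > 0" "\<beta> > 0"
  shows "degree (fps_nth (genM r \<beta> c) n) = n"
proof (rule antisym)
  show "degree (fps_nth (genM r \<beta> c) n) \<le> n"
    unfolding genM_nth 
    by (intro degree_sum_le order_trans[OF degree_smult_le]) (use assms in \<open>auto simp: degree_hypPart\<close>)
qed (rule le_degree[OF genM_nth_lead[OF assms]])

section \<open>Linear functionals applied to the generating function\<close>

definition hypSeq :: "real \<Rightarrow> (real poly \<Rightarrow> real) \<Rightarrow> real poly \<Rightarrow> real fps" where
  "hypSeq \<beta> L q = Abs_fps (\<lambda>k. L (q * fps_nth (hypPart \<beta>) k))"

locale poly_functional =
  fixes L :: "real poly \<Rightarrow> real"
  assumes L_add: "L (p + q) = L p + L q" and L_smult: "L (smult a p) = a * L p"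
begin

lemma L_0 [simp]: "L 0 = 0"
  using L_smult[of 0 0] by simp

lemma L_sum: "L (sum f A) = (\<Sum>x\<in>A. L (f x))"
  by (induction A rule: infinite_finite_induct) (auto simp: L_add)

text \<open>A Horner step: \<open>pCons a q\<close> is a + x q, and multiplication by x becomes the
  operator \<open>lagFpsD\<close> in z.\<close>

lemma hypSeq_pCons:
  assumes "\<beta> > 0"
  shows "hypSeq \<beta> L (pCons a q) = fps_const a * hypSeq \<beta> L 1 + lagFpsD \<beta> (hypSeq \<beta> L q)"
proof (rule fps_ext)
  fix k
  let ?F = "fps_nth (hypPart \<beta>)"
  have "pCons a q * ?F k = smult a (?F k) + q * ([:0, 1:] * ?F k)"
    by (simp add: mult_ac)
  also have "\<dots> = smult a (1 * ?F k) + (smult (real (Suc k) * (\<beta> + real k)) (q * ?F (Suc k)) + smult (real k) (q * ?F k))"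
    unfolding hypPart_recurrence[OF assms] by (simp add: algebra_simps)
  finally have "L (pCons a q * ?F k) = a * L (1 * ?F k) + ((real (Suc k) * (\<beta> + real k)) * L (q * ?F (Suc k)) + real k * L (q * ?F k))"
    by (simp only: L_add L_smult)
  thus "fps_nth (hypSeq \<beta> L (pCons a q)) k = fps_nth (fps_const a * hypSeq \<beta> L 1 + lagFpsD \<beta> (hypSeq \<beta> L q)) k"
    by (cases k) (auto simp: hypSeq_def lagFpsD_def algebra_simps)
qed

text \<open>The exponential factor does not involve x, so it passes through the functional.\<close>

lemma L_genM: "L (q * fps_nth (genM r \<beta> c) n) = fps_nth (expPart r c * hypSeq \<beta> L q) n"
  by (simp add: genM_nth fps_mult_nth hypSeq_def sum_distrib_left L_sum L_smult atLeast0AtMost)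

text \<open>Induction along the Horner scheme: each factor x applies \<open>lagPolyD\<close> and
  raises the degree by 2 m + 1, so the added monomial of degree i never meets the leading
  term.\<close>

lemma hypSeq_poly:
  assumes \<beta>: "\<beta> > 0" and \<phi>: "degree \<phi> \<le> m" "coeff \<phi> m ^ 2 \<noteq> (if m = 0 then coeff \<phi> m else 0)"
    and B: "fps_deriv B = - (fps_of_poly \<phi> * B)"
    and one: "hypSeq \<beta> L 1 = B * fps_of_poly (monom \<kappa> i)" "\<kappa> \<noteq> 0"
    and q: "q \<noteq> 0"
  obtains p where "p \<noteq> 0" "degree p = i + degree q * (2 * m + 1)" "hypSeq \<beta> L q = B * fps_of_poly p"
proof -
  have "\<exists>p. p \<noteq> 0 \<and> degree p = i + degree q * (2 * m + 1) \<and> hypSeq \<beta> L q = B * fps_of_poly p"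
    using q
  proof (induction q)
    case (pCons a q)
    have st: "fps_const a * hypSeq \<beta> L 1 = B * fps_of_poly (monom (a * \<kappa>) i)"
      unfolding one by (simp add: fps_of_poly_monom mult_ac flip: fps_const_mult)
    show ?case
    proof (cases "q = 0")
      case True
      hence "a \<noteq> 0" using pCons.prems by simp
      moreover have "hypSeq \<beta> L 0 = 0" by (simp add: hypSeq_def fps_eq_iff)
      ultimately show ?thesis
        using True hypSeq_pCons[OF \<beta>, of a q] st one(2)
        by (intro exI[of _ "monom (a * \<kappa>) i"]) (auto simp: lagFpsD_def degree_monom_eq)
    next
      case False
      then obtain p where p: "p \<noteq> 0" "degree p = i + degree q * (2 * m + 1)" "hypSeq \<beta> L q = B * fps_of_poly p"
        using pCons.IH by blast
      let ?p = "monom (a * \<kappa>) i + lagPolyD \<beta> \<phi> p"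
      have d: "degree (lagPolyD \<beta> \<phi> p) = i + degree (pCons a q) * (2 * m + 1)"
        using degree_lagPolyD[OF \<phi> p(1)] p(2) False by simp
      have "degree (monom (a * \<kappa>) i) < degree (lagPolyD \<beta> \<phi> p)"
        using degree_monom_le[of "a * \<kappa>" i] d False by simp
      hence "degree ?p = i + degree (pCons a q) * (2 * m + 1)"
        using d by (simp add: degree_add_eq_right)
      moreover from this have "?p \<noteq> 0" using False by (metis degree_0 degree_pCons_eq add_is_0 mult_is_0 Suc_neq_Zero Suc_eq_plus1)
      moreover have "hypSeq \<beta> L (pCons a q) = B * fps_of_poly ?p"
        unfolding hypSeq_pCons[OF \<beta>] st p(3) lagFpsD_conj[OF B] by (simp add: fps_of_poly_add algebra_simps)
      ultimately show ?thesis by blast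
    qed
  qed simp
  thus ?thesis using that by blast
qed

end

subsection \<open>Evaluation of the functionals\<close>

lemma power_le_fact_mult_exp:
  assumes "x \<ge> (0::real)"
  shows "x ^ n \<le> fact n * exp x"
proof -
  have "(\<Sum>k\<in>{n}. x ^ k /\<^sub>R fact k) \<le> (\<Sum>k. x ^ k /\<^sub>R fact k)"
    by (rule sum_le_suminf) (use assms summable_exp[of x] in auto)
  thus ?thesis by (simp add: exp_def field_simps)
qed

lemma poly_exp_bounded:
  fixes b :: real
  assumes "b > 1" "r > 0"
  shows "\<exists>C. \<forall>t\<ge>0. \<bar>poly q t * exp (t - b * t ^ r)\<bar> \<le> C"
proof -
  define C where "C = (\<Sum>j\<le>degree q. \<bar>coeff q j\<bar> * (fact j / (b - 1) ^ j)) * exp b"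
  have "\<bar>poly q t * exp (t - b * t ^ r)\<bar> \<le> C" if t: "t \<ge> 0" for t
  proof -
    \<comment> \<open>A line of negative slope dominates the exponent; its constant b absorbs t
      \<le> 1, where t^r may lie below t. For r = 1 the decay rests on b > 1.\<close>
    have "t - b * t ^ r \<le> b - (b - 1) * t"
    proof (cases "t \<le> 1")
      case True
      have "b * t \<le> b * 1" using True assms by (intro mult_left_mono) auto
      moreover have "b * t ^ r \<ge> 0" using assms t by simp
      ultimately show ?thesis by (simp add: algebra_simps)
    next
      case False
      hence "b * t \<le> b * t ^ r" using assms by (intro mult_left_mono) (auto intro!: self_le_power)
      thus ?thesis using assms unfolding left_diff_distrib by linarith
    qed
    hence e: "exp (t - b * t ^ r) \<le> exp b * exp (- ((b - 1) * t))"
      by (simp flip: exp_add)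
    have m: "t ^ j * exp (- ((b - 1) * t)) \<le> fact j / (b - 1) ^ j" for j
    proof -
      have "(b - 1) ^ j * t ^ j \<le> fact j * exp ((b - 1) * t)"
        using power_le_fact_mult_exp[of "(b - 1) * t" j] assms t by (simp add: power_mult_distrib)
      hence "(b - 1) ^ j * t ^ j * exp (- ((b - 1) * t)) \<le> fact j"
        unfolding exp_minus by (simp add: pos_divide_le_eq flip: divide_inverse)
      thus ?thesis using assms by (simp add: pos_le_divide_eq mult_ac)
    qed
    have "\<bar>poly q t * exp (t - b * t ^ r)\<bar> \<le> (\<Sum>j\<le>degree q. \<bar>coeff q j\<bar> * t ^ j) * (exp b * exp (- ((b - 1) * t)))"
      unfolding abs_mult poly_altdef
      by (intro mult_mono order_trans[OF sum_abs] sum_nonneg) (use e t in \<open>auto simp: abs_mult\<close>)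
    also have "\<dots> = (\<Sum>j\<le>degree q. \<bar>coeff q j\<bar> * (t ^ j * exp (- ((b - 1) * t)))) * exp b"
      by (simp add: sum_distrib_left sum_distrib_right mult_ac)
    also have "\<dots> \<le> C"
      unfolding C_def by (intro mult_right_mono sum_mono mult_left_mono m) auto
    finally show ?thesis .
  qed
  thus ?thesis by blast
qed

text \<open>Polynomial factor of the n-th derivative of t^i exp(t - b t^r).\<close>

fun derivPoly :: "nat \<Rightarrow> real \<Rightarrow> nat \<Rightarrow> nat \<Rightarrow> real poly" where
  "derivPoly r b i 0 = monom 1 i"
| "derivPoly r b i (Suc n) = pderiv (derivPoly r b i n) + ([:1:] + monom (- b * real r) (r - 1)) * derivPoly r b i n"

lemma bdd_smooth0_poly_exp:
  assumes "b > 1" "r > 0"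
  shows "bdd_smooth0 (\<lambda>n t. poly (derivPoly r b i n) t * exp (t - b * t ^ r))"
  unfolding bdd_smooth0_def
proof (intro conjI allI poly_exp_bounded[OF assms])
  fix n t
  show "((\<lambda>t. poly (derivPoly r b i n) t * exp (t - b * t ^ r)) has_real_derivative
          poly (derivPoly r b i (Suc n)) t * exp (t - b * t ^ r)) (at t)"
    by (auto intro!: derivative_eq_intros simp: poly_monom algebra_simps)
qed

text \<open>The n-th derivative at 0 is n! times a Taylor coefficient. This is checked formally:
  differentiating \<open>derivPoly\<close> at index m times E gives index m + 1, so the induction on
  n runs over all m.\<close>

lemma derivPoly_eval_0:
  assumes "r > 0"
  shows "poly (derivPoly r b i n) 0 = fact n * fps_nth (fps_X ^ i * (fps_exp 1 * (fps_exp (- b) oo fps_X ^ r))) n"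
proof -
  define E where "E = fps_exp 1 * (fps_exp (- b) oo fps_X ^ r)"
  let ?\<phi> = "[:1:] + monom (- b * real r) (r - 1)"
  have dE: "fps_deriv E = fps_of_poly ?\<phi> * E"
    unfolding E_def by (rule fps_exp_oo_power_deriv[OF assms])
  have E0: "fps_nth E 0 = 1"
    using assms by (simp add: E_def fps_nth_compose_X_power)
  have "fact n * fps_nth (fps_of_poly (derivPoly r b i m) * E) n = poly (derivPoly r b i (m + n)) 0" for m
  proof (induction n arbitrary: m)
    case 0
    show ?case by (simp add: E0 poly_0_coeff_0)
  next
    case (Suc n)
    have "fps_deriv (fps_of_poly (derivPoly r b i m) * E) = fps_of_poly (derivPoly r b i (Suc m)) * E"
      unfolding derivPoly.simps fps_deriv_mult dE fps_of_poly_add fps_of_poly_mult fps_of_poly_pderiv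
      by (simp only: ring_distribs mult_ac add_ac)
    hence "real (Suc n) * fps_nth (fps_of_poly (derivPoly r b i m) * E) (Suc n) =
           fps_nth (fps_of_poly (derivPoly r b i (Suc m)) * E) n"
      using fps_deriv_nth[of "fps_of_poly (derivPoly r b i m) * E" n] by simp
    hence "fact (Suc n) * fps_nth (fps_of_poly (derivPoly r b i m) * E) (Suc n) =
           fact n * fps_nth (fps_of_poly (derivPoly r b i (Suc m)) * E) n"
      by (simp only: fact_Suc) (simp add: mult_ac)
    thus ?case using Suc[of "Suc m"] by (simp only: add_Suc add_Suc_right)
  qed
  from this[of 0] show ?thesis by (simp add: fps_of_poly_monom E_def)
qed

text \<open>The polynomials (-x)_n are, up to constants, the coefficients of \<open>hypPart\<close>.
  Their images are Taylor coefficients of g by \<open>lagW_moment_sums\<close>, and \<Gamma>(\<beta>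
  + n) / \<Gamma>(\<beta>) leaves (\<beta>)_n.\<close>

lemma Lterm_pochhammer_sums:
  assumes r: "r > 0" and \<beta>: "\<beta> > 0" and c: "0 < c" "c < 1"
  shows "Lterm r \<beta> c i (pochhammer (- [:0, 1:]) n) sums
     ((-1) ^ i / sqrt (fact i * pochhammer \<beta> i) * (pochhammer \<beta> n * fact n *
        fps_nth (fps_X ^ i * (fps_exp 1 * (fps_exp (- (1 / (1 - c))) oo fps_X ^ r))) n))"
proof -
  let ?b = "1 / (1 - c)"
  let ?H = "\<lambda>n t. poly (derivPoly r ?b i n) t * exp (t - ?b * t ^ r)"
  let ?K = "(-1) ^ i / (Gamma \<beta> * sqrt (fact i * pochhammer \<beta> i))"
  have b: "?b > 1" using c by simp
  have p: "poly (pochhammer (- [:0, 1:]) n) x = pochhammer (- x) n" for x :: real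
    by (induction n) (auto simp: pochhammer_Suc of_nat_poly algebra_simps)
  have H0: "?H 0 = (\<lambda>t. t ^ i * exp (t - ?b * t ^ r))" by (simp add: poly_monom)
  have "(\<lambda>k. ?K * (pochhammer (- real k) n * (pochhammer \<beta> k / fact k * lagW \<beta> k (?H 0)))) sums (?K * (Gamma (\<beta> + real n) * ?H n 0))"
    by (intro sums_mult lagW_moment_sums[OF \<beta> bdd_smooth0_poly_exp[OF b r]])
  also have "(\<lambda>k. ?K * (pochhammer (- real k) n * (pochhammer \<beta> k / fact k * lagW \<beta> k (?H 0)))) =
              Lterm r \<beta> c i (pochhammer (- [:0, 1:]) n)"
    unfolding Lterm_def wgt_eq_lagW[OF r \<beta> c(2)] p H0 by (simp add: mult_ac)
  also have "?H n 0 = fact n * fps_nth (fps_X ^ i * (fps_exp 1 * (fps_exp (- ?b) oo fps_X ^ r))) n"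
    unfolding derivPoly_eval_0[OF r] using r by simp
  finally show ?thesis
    using Gamma_real_pos[OF \<beta>] unfolding Gamma_plus_nat[OF \<beta>] by (simp add: mult_ac)
qed

lemma Lterm_add: "Lterm r \<beta> c i (p + q) k = Lterm r \<beta> c i p k + Lterm r \<beta> c i q k"
  by (simp add: Lterm_def algebra_simps add_divide_distrib)

lemma Lterm_smult: "Lterm r \<beta> c i (smult a p) k = a * Lterm r \<beta> c i p k"
  by (simp add: Lterm_def)

text \<open>No estimate of the weights is required: x (-x)_n = n (-x)_n - (-x)_(n+1) reduces every
  polynomial to the summable case above. The induction on f therefore carries an arbitrary factor
  (-x)_n.\<close>

lemma Lterm_summable:
  assumes "r > 0" "\<beta> > 0" "0 < c" "c < 1"
  shows "summable (Lterm r \<beta> c i f)"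
proof -
  let ?P = "\<lambda>n. pochhammer (- [:0, 1::real:]) n"
  have "summable (Lterm r \<beta> c i (f * ?P n))" for n
  proof (induction f arbitrary: n)
    case 0
    then show ?case by (simp add: Lterm_def)
  next
    case (pCons a f)
    have "pCons a f * ?P n = smult a (?P n) + (smult (real n) (f * ?P n) + smult (-1) (f * ?P (Suc n)))"
      by (simp add: pochhammer_Suc of_nat_poly algebra_simps)
    thus ?case using Lterm_pochhammer_sums[OF assms, of i n] pCons.IH[of n] pCons.IH[of "Suc n"]
      by (simp only: Lterm_add[abs_def] Lterm_smult[abs_def])
         (intro summable_add summable_mult; simp add: sums_iff)
  qed
  from this[of 0] show ?thesis by simp
qed

theorem mainTheorem1:
  fixes r :: nat and \<beta> c :: real
  assumes "r \<ge> 1" and "\<beta> > 0" and "0 < c" and "c < 1"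
  shows "(\<forall>i < 2 * r - 1. \<forall>f. summable (Lterm r \<beta> c i f)) \<and>
         d_orthogonal (2 * r - 1) (Mpoly r \<beta> c) (Lfun r \<beta> c)"
proof -
  have r: "r > 0" using assms by simp
  note summable = Lterm_summable[OF r assms(2-4)]
  \<comment> \<open>\<open>B\<close> is the inverse of the exponential factor and -\<phi> its
    logarithmic derivative, so \<phi> is what conjugation by \<open>B\<close> subtracts from the
    derivative.\<close>
  define a where "a = (-1) ^ r / (1 - c)"
  define B where "B = fps_exp (- 1) * (fps_exp (- a) oo fps_X ^ r)"
  define \<phi> where "\<phi> = [:1:] + monom (a * real r) (r - 1)"
  have A: "expPart r c = fps_exp 1 * (fps_exp a oo fps_X ^ r)"
    by (simp add: expPart_def a_def)
  have AB: "expPart r c * B = 1"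
    unfolding A B_def by (rule fps_exp_oo_power_inverse[OF r])
  have "[:- 1:] + monom (- a * real r) (r - 1) = - \<phi>"
    by (simp add: \<phi>_def minus_monom)
  hence B: "fps_deriv B = - (fps_of_poly \<phi> * B)"
    unfolding B_def fps_exp_oo_power_deriv[OF r] by (simp add: fps_of_poly_uminus)
  have d: "2 * r - 1 = 2 * (r - 1) + 1" using r by simp
  have \<phi>1: "degree \<phi> \<le> r - 1"
    unfolding \<phi>_def by (intro degree_add_le) (auto intro: degree_monom_le)
  \<comment> \<open>For r = 1, \<phi> is the constant -c / (1 - c), which is negative and so differs
    from its square. For r > 1 the coefficient is a r, which is nonzero.\<close>
  have \<phi>2: "coeff \<phi> (r - 1) ^ 2 \<noteq> (if r - 1 = 0 then coeff \<phi> (r - 1) else 0)"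
  proof (cases "r = 1")
    case True
    have "coeff \<phi> (r - 1) = - c / (1 - c)"
      using True assms by (simp add: \<phi>_def a_def field_simps)
    moreover have "(- c / (1 - c)) ^ 2 > 0" "- c / (1 - c) < 0"
      using assms by (auto simp: field_simps)
    ultimately show ?thesis by (smt (verit))
  next
    case False
    hence "coeff \<phi> (r - 1) = a * real r" using r by (simp add: \<phi>_def coeff_pCons split: nat.splits)
    thus ?thesis using False r assms by (simp add: a_def)
  qed
  \<comment> \<open>Both orthogonality conditions can be read off from p: coefficients beyond the
    degree vanish, and the leading one does not.\<close>
  have main: "\<exists>p. p \<noteq> 0 \<and> degree p = m * (2 * r - 1) + i \<and> (\<forall>n. Lfun r \<beta> c i (Mpoly r \<beta> c m * Mpoly r \<beta> c n) = fact n * coeff p n)"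
    for i m
  proof -
    let ?L = "Lfun r \<beta> c i"
    interpret poly_functional ?L
      by unfold_locales
         (simp_all add: Lfun_def Lterm_add[abs_def] Lterm_smult[abs_def] suminf_add[OF summable summable, symmetric]
            suminf_mult[OF summable])
    define \<kappa> where "\<kappa> = 1 / sqrt (fact i * pochhammer \<beta> i)"
    have \<kappa>: "\<kappa> \<noteq> 0" using pochhammer_pos[OF assms(2), of i] by (simp add: \<kappa>_def)
    have one: "hypSeq \<beta> ?L 1 = B * fps_of_poly (monom \<kappa> i)"
    proof (rule fps_ext)
      fix n
      have Bm: "B * fps_of_poly (monom \<kappa> i) = fps_const \<kappa> * (fps_X ^ i * B)"
        by (simp add: fps_of_poly_monom mult_ac)
      let ?e = "fps_nth (fps_exp 1 * (fps_exp (- (1 / (1 - c))) oo fps_X ^ r))"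
      have P: "pochhammer \<beta> n > 0" using assms by (intro pochhammer_pos)
      have "?L (pochhammer (- [:0, 1:]) n) = (-1) ^ i * \<kappa> * (pochhammer \<beta> n * fact n *
             fps_nth (fps_X ^ i * (fps_exp 1 * (fps_exp (- (1 / (1 - c))) oo fps_X ^ r))) n)"
        unfolding Lfun_def \<kappa>_def using sums_unique[OF Lterm_pochhammer_sums[OF r assms(2-4), of i n]] by simp
      \<comment> \<open>The sign (-1)^n comes from \<open>hypPart\<close> and (-1)^i from the
        weight; together they give the reflection z to -z that turns the Taylor series of g / t^i
        into \<open>B\<close>.\<close>
      hence "fps_nth (hypSeq \<beta> ?L 1) n = \<kappa> * ((-1) ^ n * (-1) ^ i * (if n < i then 0 else ?e (n - i)))"
        unfolding fps_X_power_mult_nth using P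
        by (simp add: hypSeq_def hypPart_def L_smult)
      also have "(-1) ^ n * (-1) ^ i * (if n < i then 0 else ?e (n - i)) = (if n < i then 0 else fps_nth B (n - i))"
      proof (cases "n < i")
        case False
        hence "(-1 :: real) ^ n * (-1) ^ i = (-1) ^ (n - i)"
          by (simp add: minus_one_power_iff)
        moreover have "fps_nth B (n - i) = (-1) ^ (n - i) * ?e (n - i)"
          using fps_exp_oo_power_reflect[OF r, of 1 "- (1 / (1 - c))" "n - i"] by (simp add: B_def a_def)
        ultimately show ?thesis using False by simp
      qed simp
      finally show "fps_nth (hypSeq \<beta> ?L 1) n = fps_nth (B * fps_of_poly (monom \<kappa> i)) n"
        unfolding Bm by (simp add: fps_X_power_mult_nth)
    qed
    let ?q = "Mpoly r \<beta> c m"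
    have deg: "degree ?q = m" and nz: "?q \<noteq> 0"
      using degree_genM[OF r assms(2)] genM_nth_nonzero[OF r assms(2)] by (simp_all add: Mpoly_def)
    obtain p where p: "p \<noteq> 0" "degree p = i + degree ?q * (2 * (r - 1) + 1)" "hypSeq \<beta> ?L ?q = B * fps_of_poly p"
      using hypSeq_poly[OF assms(2) \<phi>1 \<phi>2 B one \<kappa> nz] .
    have "?L (?q * Mpoly r \<beta> c n) = fact n * coeff p n" for n
    proof -
      have "?L (?q * Mpoly r \<beta> c n) = fact n * ?L (?q * fps_nth (genM r \<beta> c) n)"
        unfolding Mpoly_def[of _ _ _ n] by (simp add: L_smult)
      \<comment> \<open>The exponential factor cancels \<open>B\<close>, leaving the polynomial p
        itself.\<close>
      also have "?L (?q * fps_nth (genM r \<beta> c) n) = coeff p n"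
        unfolding L_genM p(3) mult.assoc[symmetric] AB by simp
      finally show ?thesis .
    qed
    thus ?thesis using p deg d by (intro exI[of _ p]) (simp add: add_ac)
  qed
  have "Lfun r \<beta> c i (Mpoly r \<beta> c m * Mpoly r \<beta> c n) = 0" if "n \<ge> m * (2 * r - 1) + i + 1" for i m n
    using main[of m i] that by (auto simp: coeff_eq_0)
  moreover have "Lfun r \<beta> c i (Mpoly r \<beta> c n * Mpoly r \<beta> c (n * (2 * r - 1) + i)) \<noteq> 0" for i n
    using main[of n i] by (metis leading_coeff_0_iff fact_nonzero mult_eq_0_iff)
  moreover have "degree (Mpoly r \<beta> c n) = n" for n
    using degree_genM[OF r assms(2)] by (simp add: Mpoly_def)
  ultimately show ?thesis
    unfolding d_orthogonal_def using summable by blast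
qed

end
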